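(* Let $K$ be a field. Fix a positive $\mathbb{Z}^2/\mathbb{Z}\mathbf{c}$-grading on $K[x,y]$, and let $M,N\subset K[x,y]$ be monomial ideals of finite colength with the same Hilbert function $H$. Suppose $M>N$ with respect to the partial order induced by $\prec$. For a minimal generator $n$ of $N$ and a standard monomial $s$ for $M$ (a monomial $s\notin M$) with $\deg(n)=\deg(s)$, let $$F_{(n,s)}=\sum_{\mathcal{H}\text{ hike from } n\text{ to } s}a_{\mathcal{H}}\in K[T_+(M),T_-(N)].$$ Then the ideal of the edge-scheme $E(M,N)$ as a subscheme of $C_{\prec}(M)\times C_{\prec^{\mathrm{opp}}}(N)\cong\mathrm{Spec}\,K[T_+(M),T_-(N)]$ is $$I(M,N)=\langle F_{(n,s)} \mid n\text{ a minimal generator of }N,\ s\notin M\text{ a monomial},\ \deg(n)=\deg(s)\rangle .$$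
   Context: Grading: $\mathbf{c}=(\beta,-\alpha)$ with $\alpha,\beta$ relatively prime positive integers, $\deg(x)=\alpha$, $\deg(y)=\beta$, $r=x^{\beta}y^{-\alpha}$. $\prec$ is the lexicographic order with $x\prec y$, $\prec^{\mathrm{opp}}$ the lexicographic order with $y\prec^{\mathrm{opp}}x$. $\mathbb{H}_{\mathbf{c}}(H)$ is the multigraded Hilbert scheme of homogeneous ideals in $K[x,y]$ with Hilbert function $H$ (i.e. $\dim_K(K[x,y]/I)_a=H(a)$). $M>N$ means there is a degree-preserving bijection $f$ from the monomials of $M$ to those of $N$ with $m\succeq f(m)$ for all $m$. $C_{\prec}(M)=\{I\in\mathbb{H}_{\mathbf{c}}(H):\mathrm{in}_{\prec}I=M\}$, a subscheme of $\mathbb{H}_{\mathbf{c}}(H)$, and similarly $C_{\prec^{\mathrm{opp}}}(N)$; the edge-scheme is the scheme-theoretic intersection $E(M,N)=C_{\prec}(M)\cap C_{\prec^{\mathrm{opp}}}(N)=C_{\prec}(M)\times_{\mathbb{H}_{\mathbf{c}}(H)}C_{\prec^{\mathrm{opp}}}(N)$. Significant arrows: let $m_0=x^{a_0}\prec m_1=x^{a_1}y^{b_1}\prec\dots\prec m_e=y^{b_e}$ be the minimal generators of $M$ and $w_i=\mathrm{lcm}(m_{i-1},m_i)$, $1\le i\le e$. $T_+(M)$ is the set of pairs $c_i^{\ell}=(m_i,\ell)$, $1\le i\le e$, $\ell\in\mathbb{Z}_{>0}$, with $m_ir^{\ell}$ a monomial not in $M$ and $w_ir^{\ell}\in M$;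 these are also used as variables. For a monomial $m\in M$, $j(m)=\max\{j:m_j\mid m\}$. Parametrization: put $f_0=m_0$, $f_i=\frac{m_i}{m_{i-1}}f_{i-1}+\sum_{c_i^{\ell}\in T_+(M)}c_i^{\ell}\frac{m_ir^{\ell}}{m_{j(w_ir^{\ell})}}f_{j(w_ir^{\ell})}\in K[T_+(M)][x,y]$, and $I_{\prec}(M)=\langle f_0,\dots,f_e\rangle$. By a theorem of Evain, the map $\mathrm{Spec}\,K[T_+(M)]\to\mathbb{H}_{\mathbf{c}}(H)$ induced by $I_{\prec}(M)$ is an isomorphism onto $C_{\prec}(M)$. Exchanging the roles of $x$ and $y$ (so $\prec$ becomes $\prec^{\mathrm{opp}}$ and $r$ becomes $r^{-1}$) gives for $N$, with minimal generators $n_0\prec^{\mathrm{opp}}n_1\prec^{\mathrm{opp}}\cdots$ ($n_0$ a power of $y$), the set $T_-(N)$ of pairs $\widetilde c_k^{\,\ell}=(n_k,\ell)$, $k\ge1$, $\ell\in\mathbb{Z}_{>0}$, with $n_kr^{-\ell}$ a monomial not in $N$ and $\mathrm{lcm}(n_{k-1},n_k)r^{-\ell}\in N$, and the analogous identification $C_{\prec^{\mathrm{opp}}}(N)\cong\mathrm{Spec}\,K[T_-(N)]$. Paths: a path from a generator $m_i$ of $M$ is a sequence $\mathcal{P}=(c_{i_1}^{\ell_1},\dots,c_{i_d}^{\ell_d})$ of elements of $T_+(M)$ defined inductively: (a) if $c_i^{\ell}\in T_+(M)$ then $(c_i^{\ell})$ is a path from $m_i$; (b) otherwise either $(c_{i_1}^{\ell_1},\dots,c_{i_d}^{\ell_d})$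 is a path from $m_{i-1}$, or $i_1=i$ and $(c_{i_2}^{\ell_2},\dots,c_{i_d}^{\ell_d})$ is a path from $m_{j(w_ir^{\ell_1})}$. Its length is $\ell(\mathcal{P})=\ell_1+\dots+\ell_d$, it is a path from $m_i$ to $m_ir^{\ell(\mathcal{P})}$, and $a_{\mathcal{P}}=\prod_k c_{i_k}^{\ell_k}$. Walks: a walk from $m_i$ to a monomial $s$ is a sequence of paths $\mathcal{W}=(\mathcal{P}_1,\dots,\mathcal{P}_d)$, $d\ge1$, with $\mathcal{P}_1$ a path from $m_i$, $m_ir^{\ell(\mathcal{P}_1)+\dots+\ell(\mathcal{P}_k)}\in M$ for $1\le k\le d-1$, $\mathcal{P}_k$ a path from $m_{j(m_ir^{\ell(\mathcal{P}_1)+\dots+\ell(\mathcal{P}_{k-1})})}$ for $2\le k\le d$, and $m_ir^{\ell(\mathcal{P}_1)+\dots+\ell(\mathcal{P}_d)}=s$. Its length is $\ell(\mathcal{W})=\sum_k\ell(\mathcal{P}_k)$, and $a_{\mathcal{W}}=(-1)^{d+1}\prod_ka_{\mathcal{P}_k}$. Strolls: a stroll from a monomial $m\in M$ to a standard monomial $s\notin M$ is a sequence of walks $\mathcal{S}=(\mathcal{W}_1,\dots,\mathcal{W}_d)$, $d\ge1$, each ending at a standard monomial of $M$, with $\mathcal{W}_1$ a walk from $m_{j(m)}$, $mr^{\ell(\mathcal{W}_1)+\dots+\ell(\mathcal{W}_{k-1})}\in M$ and $\mathcal{W}_k$ a walk from $m_{j(mr^{\ell(\mathcal{W}_1)+\dots+\ell(\mathcal{W}_{k-1})})}$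 for $2\le k\le d$, and $mr^{\ell(\mathcal{W}_1)+\dots+\ell(\mathcal{W}_d)}=s$; put $a_{\mathcal{S}}=(-1)^d\prod_ka_{\mathcal{W}_k}$. There is also the trivial stroll from a standard monomial $s$ to itself, with $a_{\mathcal{S}}=1$ (the only stroll starting at a standard monomial). Paths for $N$ with respect to $\prec^{\mathrm{opp}}$: write $\widetilde w_k=\mathrm{lcm}(n_{k-1},n_k)$ for $k\ge1$ and, for a monomial $m\in N$, $\widetilde{\jmath}(m)=\max\{j:n_j\mid m\}$. A path for $N$ with respect to $\prec^{\mathrm{opp}}$ from a generator $n_k$ of $N$ is a sequence $\mathcal{P}'=(\widetilde c_{k_1}^{\,\ell_1},\dots,\widetilde c_{k_d}^{\,\ell_d})$ of elements of $T_-(N)$ defined inductively: (a) if $\widetilde c_k^{\,\ell}\in T_-(N)$ then $(\widetilde c_k^{\,\ell})$ is a path from $n_k$; (b) otherwise either $(\widetilde c_{k_1}^{\,\ell_1},\dots,\widetilde c_{k_d}^{\,\ell_d})$ is a path from $n_{k-1}$, or $k_1=k$ and $(\widetilde c_{k_2}^{\,\ell_2},\dots,\widetilde c_{k_d}^{\,\ell_d})$ is a path from $n_{\widetilde{\jmath}(\widetilde w_kr^{-\ell_1})}$. Its length is $\ell(\mathcal{P}')=\ell_1+\dots+\ell_d$, it is a path from $n_k$ to $n_kr^{-\ell(\mathcal{P}')}$, and $a_{\mathcal{P}'}=\prod_q\widetilde c_{k_q}^{\,\ell_q}$. Hikes: a hike from a minimal generator $n$ of $N$ to a standard monomial $s$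 for $M$ is a pair $\mathcal{H}=(\mathcal{P}',\mathcal{S})$, where $\mathcal{P}'$ is either a path for $N$ with respect to $\prec^{\mathrm{opp}}$ from $n$ to some monomial $m\succ n$, or the arrow of length zero, in which case $m=n$ and $a_{\mathcal{P}'}=1$; and $\mathcal{S}$ is a stroll for $M$ from $m$ to $s$. Put $a_{\mathcal{H}}=a_{\mathcal{P}'}a_{\mathcal{S}}\in K[T_+(M),T_-(N)]$. *)

theory Defs
  imports Complex_Main "HOL-Library.Poly_Mapping" "HOL-Library.Product_Plus"
begin

section \<open>Bivariate polynomials and ideals\<close>

text \<open>The pair (a, b) stands for the monomial \<open>x^a y^b\<close>, so that \<open>'a poly2\<close> is A[x,y].\<close>

type_synonym mon = "nat \<times> nat"

type_synonym 'a poly2 = "mon \<Rightarrow>\<^sub>0 'a"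

definition monom :: "'m \<Rightarrow> 'm \<Rightarrow>\<^sub>0 'a::comm_ring_1"
  where "monom m = Poly_Mapping.single m 1"

definition const :: "'a \<Rightarrow> 'm::comm_monoid_add \<Rightarrow>\<^sub>0 'a::comm_ring_1"
  where "const c = Poly_Mapping.single 0 c"

text \<open>A commutative ring is a module over itself; its submodules are its ideals.\<close>

abbreviation is_ideal :: "'r::comm_ring_1 set \<Rightarrow> bool"
  where "is_ideal \<equiv> module.subspace (*)"

abbreviation ideal_gen :: "'r::comm_ring_1 set \<Rightarrow> 'r set"
  where "ideal_gen \<equiv> module.span (*)"

definition Mons :: "'a::comm_ring_1 poly2 set \<Rightarrow> mon set"
  where "Mons I = {m. monom m \<in> I}"

definition monomial_ideal :: "'a::comm_ring_1 poly2 set \<Rightarrow> bool"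
  where "monomial_ideal I \<longleftrightarrow> (\<exists>S. I = ideal_gen (monom ` S))"

definition finite_colength :: "'k::field poly2 set \<Rightarrow> bool"
  where "finite_colength I \<longleftrightarrow>
    (\<exists>B. finite B \<and> (\<forall>p. \<exists>q \<in> module.span (\<lambda>c f. const c * f) B. p - q \<in> I))"

section \<open>Grading and the multigraded Hilbert scheme\<close>

text \<open>
  As \<open>\<alpha>\<close> and \<open>\<beta>\<close> are coprime, \<open>(a, b) \<mapsto> \<alpha> a + \<beta> b\<close> identifies the grading group
  with the integers; only nonnegative degrees occur.
\<close>

definition mdeg :: "nat \<Rightarrow> nat \<Rightarrow> mon \<Rightarrow> nat"
  where "mdeg \<alpha> \<beta> m = \<alpha> * fst m + \<beta> * snd m"

definition homog :: "nat \<Rightarrow> nat \<Rightarrow> nat \<Rightarrow> 'a::comm_ring_1 poly2 \<Rightarrow> bool"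
  where "homog \<alpha> \<beta> d f \<longleftrightarrow> (\<forall>m \<in> Poly_Mapping.keys f. mdeg \<alpha> \<beta> m = d)"

definition homog_ideal :: "nat \<Rightarrow> nat \<Rightarrow> 'a::comm_ring_1 poly2 set \<Rightarrow> bool"
  where "homog_ideal \<alpha> \<beta> I \<longleftrightarrow> is_ideal I \<and> ideal_gen {f \<in> I. \<exists>d. homog \<alpha> \<beta> d f} = I"

text \<open>
  \<open>e 0, \<dots>, e (h - 1)\<close> become a basis of the degree d part of A[x,y]/I after inverting g.
  The powers of g clear denominators.  For g = 1 this says that they are a basis.
\<close>

definition quot_basis ::
    "nat \<Rightarrow> nat \<Rightarrow> 'a::comm_ring_1 \<Rightarrow> 'a poly2 set \<Rightarrow> nat \<Rightarrow> nat \<Rightarrow> (nat \<Rightarrow> 'a poly2) \<Rightarrow> bool"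
  where "quot_basis \<alpha> \<beta> g I d h e \<longleftrightarrow>
    (\<forall>i<h. homog \<alpha> \<beta> d (e i)) \<and>
    (\<forall>f. homog \<alpha> \<beta> d f \<longrightarrow> (\<exists>k c. const (g ^ k) * f - (\<Sum>i<h. const (c i) * e i) \<in> I)) \<and>
    (\<forall>c. (\<Sum>i<h. const (c i) * e i) \<in> I \<longrightarrow> (\<exists>k. \<forall>i<h. g ^ k * c i = 0))"

definition has_hilbert_function ::
    "nat \<Rightarrow> nat \<Rightarrow> 'k::field poly2 set \<Rightarrow> (nat \<Rightarrow> nat) \<Rightarrow> bool"
  where "has_hilbert_function \<alpha> \<beta> I H \<longleftrightarrow>
    homog_ideal \<alpha> \<beta> I \<and> (\<forall>d. \<exists>e. quot_basis \<alpha> \<beta> 1 I d (H d) e)"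

text \<open>
  Schemes are given by their functors of points.  The A-valued points of the multigraded
  Hilbert scheme are the homogeneous ideals I of A[x,y] for which the degree d part of
  A[x,y]/I is locally free of rank H(d), that is, free of rank H(d) on each of finitely many
  basic open sets which cover Spec A.
\<close>

definition hilb_points ::
    "nat \<Rightarrow> nat \<Rightarrow> (nat \<Rightarrow> nat) \<Rightarrow> 'a::comm_ring_1 poly2 set set"
  where "hilb_points \<alpha> \<beta> H = {I. homog_ideal \<alpha> \<beta> I \<and>
    (\<forall>d. \<exists>G. finite G \<and> ideal_gen G = UNIV \<and> (\<forall>g\<in>G. \<exists>e. quot_basis \<alpha> \<beta> g I d (H d) e))}"

section \<open>Monomial orders, initial ideals and Groebner cells\<close>

text \<open>\<open>lex\<close> has x smaller than y, \<open>lex_opp\<close> has y smaller than x.\<close>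

definition lex :: "mon \<Rightarrow> mon \<Rightarrow> bool"
  where "lex m m' \<longleftrightarrow> snd m < snd m' \<or> snd m = snd m' \<and> fst m < fst m'"

definition lex_opp :: "mon \<Rightarrow> mon \<Rightarrow> bool"
  where "lex_opp m m' \<longleftrightarrow> fst m < fst m' \<or> fst m = fst m' \<and> snd m < snd m'"

definition lead_mon :: "(mon \<Rightarrow> mon \<Rightarrow> bool) \<Rightarrow> 'a::comm_ring_1 poly2 \<Rightarrow> mon"
  where "lead_mon lt f =
    (THE m. m \<in> Poly_Mapping.keys f \<and> (\<forall>m' \<in> Poly_Mapping.keys f. m' = m \<or> lt m' m))"

definition init_term :: "(mon \<Rightarrow> mon \<Rightarrow> bool) \<Rightarrow> 'a::comm_ring_1 poly2 \<Rightarrow> 'a poly2"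
  where "init_term lt f =
    Poly_Mapping.single (lead_mon lt f) (Poly_Mapping.lookup f (lead_mon lt f))"

definition init_ideal :: "(mon \<Rightarrow> mon \<Rightarrow> bool) \<Rightarrow> 'a::comm_ring_1 poly2 set \<Rightarrow> 'a poly2 set"
  where "init_ideal lt I = ideal_gen (init_term lt ` (I - {0}))"

definition extend_ideal :: "('k \<Rightarrow> 'a) \<Rightarrow> 'k::comm_ring_1 poly2 set \<Rightarrow> 'a::comm_ring_1 poly2 set"
  where "extend_ideal \<eta> I = ideal_gen (Poly_Mapping.map \<eta> ` I)"

text \<open>
  A-valued points of the cell of ideals with initial ideal M, for the K-algebra A with
  structure map \<open>\<eta>\<close>.  Initial terms carry their coefficients, so the condition says that each
  monomial of M is the monic initial term of an element of I and that the standard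
  monomials of M are independent modulo I; it is stable under base change.
\<close>

definition cell_points ::
    "nat \<Rightarrow> nat \<Rightarrow> (nat \<Rightarrow> nat) \<Rightarrow> ('k \<Rightarrow> 'a) \<Rightarrow> (mon \<Rightarrow> mon \<Rightarrow> bool) \<Rightarrow>
      'k::field poly2 set \<Rightarrow> 'a::comm_ring_1 poly2 set set"
  where "cell_points \<alpha> \<beta> H \<eta> lt M =
    {I \<in> hilb_points \<alpha> \<beta> H. init_ideal lt I = extend_ideal \<eta> M}"

text \<open>The fibre product of the two cells over the Hilbert scheme.\<close>

definition edge_points ::
    "nat \<Rightarrow> nat \<Rightarrow> (nat \<Rightarrow> nat) \<Rightarrow> ('k \<Rightarrow> 'a) \<Rightarrow> 'k::field poly2 set \<Rightarrow> 'k poly2 set \<Rightarrow>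
      ('a::comm_ring_1 poly2 set \<times> 'a poly2 set) set"
  where "edge_points \<alpha> \<beta> H \<eta> M N =
    {(I, J) \<in> cell_points \<alpha> \<beta> H \<eta> lex M \<times> cell_points \<alpha> \<beta> H \<eta> lex_opp N. I = J}"

definition mon_ideal_greater ::
    "nat \<Rightarrow> nat \<Rightarrow> 'k::field poly2 set \<Rightarrow> 'k poly2 set \<Rightarrow> bool"
  where "mon_ideal_greater \<alpha> \<beta> M N \<longleftrightarrow>
    (\<exists>f. bij_betw f (Mons M) (Mons N) \<and>
      (\<forall>m \<in> Mons M. mdeg \<alpha> \<beta> (f m) = mdeg \<alpha> \<beta> m \<and> (f m = m \<or> lex (f m) m)))"

section \<open>Significant arrows\<close>

text \<open>
  From here on S is the set of monomials of a monomial ideal, \<open>lt\<close> is one of the two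
  lexicographic orders and \<open>\<rho>\<close> is the exponent vector of r in the case of \<open>lex\<close> and of the
  inverse of r in the case of \<open>lex_opp\<close>.
\<close>

definition r_exp :: "nat \<Rightarrow> nat \<Rightarrow> int \<times> int"
  where "r_exp \<alpha> \<beta> = (int \<beta>, - int \<alpha>)"

definition r_exp_opp :: "nat \<Rightarrow> nat \<Rightarrow> int \<times> int"
  where "r_exp_opp \<alpha> \<beta> = (- int \<beta>, int \<alpha>)"

text \<open>The Laurent monomial \<open>m \<rho>^l\<close>, if it is a monomial.\<close>

definition rmul :: "int \<times> int \<Rightarrow> nat \<Rightarrow> mon \<Rightarrow> mon option"
  where "rmul \<rho> l m =
    (let a = int (fst m) + int l * fst \<rho>; b = int (snd m) + int l * snd \<rho>
     in if 0 \<le> a \<and> 0 \<le> b then Some (nat a, nat b) else None)"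

definition mdvd :: "mon \<Rightarrow> mon \<Rightarrow> bool"
  where "mdvd m m' \<longleftrightarrow> fst m \<le> fst m' \<and> snd m \<le> snd m'"

definition mlcm :: "mon \<Rightarrow> mon \<Rightarrow> mon"
  where "mlcm m m' = (max (fst m) (fst m'), max (snd m) (snd m'))"

definition min_gens :: "mon set \<Rightarrow> mon set"
  where "min_gens S = {m \<in> S. \<forall>m' \<in> S. mdvd m' m \<longrightarrow> m' = m}"

definition gens :: "(mon \<Rightarrow> mon \<Rightarrow> bool) \<Rightarrow> mon set \<Rightarrow> mon list"
  where "gens lt S = (THE ms. set ms = min_gens S \<and> sorted_wrt lt ms)"

definition wlcm :: "(mon \<Rightarrow> mon \<Rightarrow> bool) \<Rightarrow> mon set \<Rightarrow> nat \<Rightarrow> mon"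
  where "wlcm lt S i = mlcm (gens lt S ! (i - 1)) (gens lt S ! i)"

definition jmax :: "(mon \<Rightarrow> mon \<Rightarrow> bool) \<Rightarrow> mon set \<Rightarrow> mon \<Rightarrow> nat"
  where "jmax lt S m = Max {j. j < length (gens lt S) \<and> mdvd (gens lt S ! j) m}"

type_synonym arrow = "mon \<times> nat"

definition sig_arrows ::
    "(mon \<Rightarrow> mon \<Rightarrow> bool) \<Rightarrow> int \<times> int \<Rightarrow> mon set \<Rightarrow> arrow set"
  where "sig_arrows lt \<rho> S = {(gens lt S ! i, l) | i l.
    1 \<le> i \<and> i < length (gens lt S) \<and> 0 < l \<and>
    (\<exists>s. rmul \<rho> l (gens lt S ! i) = Some s \<and> s \<notin> S) \<and>
    (\<exists>w. rmul \<rho> l (wlcm lt S i) = Some w \<and> w \<in> S)}"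

section \<open>The universal families over the cells\<close>

text \<open>\<open>mon_frac m d f\<close> is (m/d) f; it is only used where d divides m f.\<close>

definition mon_frac :: "mon \<Rightarrow> mon \<Rightarrow> 'r::comm_ring_1 poly2 \<Rightarrow> 'r poly2"
  where "mon_frac m d f = (THE g. monom d * g = monom m * f)"

text \<open>
  The polynomials \<open>f_i\<close>, with the arrow c read as the ring element \<open>X c\<close>.  The test \<open>j < i\<close>
  only serves termination: \<open>w_i \<rho>^l\<close> has a smaller exponent than \<open>m_i\<close> in the variable that is
  larger for \<open>lt\<close>, so the test always succeeds.
\<close>

function fam ::
    "(mon \<Rightarrow> mon \<Rightarrow> bool) \<Rightarrow> int \<times> int \<Rightarrow> mon set \<Rightarrow> (arrow \<Rightarrow> 'r::comm_ring_1) \<Rightarrow> nat \<Rightarrow> 'r poly2"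
  where
    "fam lt \<rho> S X 0 = monom (gens lt S ! 0)"
  | "fam lt \<rho> S X (Suc i) =
      mon_frac (gens lt S ! Suc i) (gens lt S ! i) (fam lt \<rho> S X i) +
      (\<Sum>l \<in> {l. (gens lt S ! Suc i, l) \<in> sig_arrows lt \<rho> S}.
        let j = jmax lt S (the (rmul \<rho> l (wlcm lt S (Suc i)))) in
        if j < Suc i
        then const (X (gens lt S ! Suc i, l)) *
          mon_frac (the (rmul \<rho> l (gens lt S ! Suc i))) (gens lt S ! j) (fam lt \<rho> S X j)
        else 0)"
  by pat_completeness auto
termination
  by (relation "Wellfounded.measure (\<lambda>(lt, \<rho>, S, X, i). i)") auto

section \<open>The coordinate ring of the product of the cells\<close>

text \<open>
  \<open>Inl\<close> tags the arrows of M, \<open>Inr\<close> those of N.  The type \<open>'k coord_poly\<close> has a variable for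
  each element of \<open>arrow + arrow\<close>; \<open>coord_ring\<close> is the subring \<open>K[T_+(M), T_-(N)]\<close>.
\<close>

type_synonym 'k coord_poly = "((arrow + arrow) \<Rightarrow>\<^sub>0 nat) \<Rightarrow>\<^sub>0 'k"

definition var :: "arrow + arrow \<Rightarrow> 'k::comm_ring_1 coord_poly"
  where "var v = monom (Poly_Mapping.single v 1)"

definition arrows_pos :: "nat \<Rightarrow> nat \<Rightarrow> 'k::field poly2 set \<Rightarrow> arrow set"
  where "arrows_pos \<alpha> \<beta> M = sig_arrows lex (r_exp \<alpha> \<beta>) (Mons M)"

definition arrows_neg :: "nat \<Rightarrow> nat \<Rightarrow> 'k::field poly2 set \<Rightarrow> arrow set"
  where "arrows_neg \<alpha> \<beta> N = sig_arrows lex_opp (r_exp_opp \<alpha> \<beta>) (Mons N)"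

definition coord_ring ::
    "nat \<Rightarrow> nat \<Rightarrow> 'k::field poly2 set \<Rightarrow> 'k poly2 set \<Rightarrow> 'k coord_poly set"
  where "coord_ring \<alpha> \<beta> M N = {p. \<forall>t \<in> Poly_Mapping.keys p.
    Poly_Mapping.keys t \<subseteq> Inl ` arrows_pos \<alpha> \<beta> M \<union> Inr ` arrows_neg \<alpha> \<beta> N}"

definition is_ideal_of :: "'r::comm_ring_1 set \<Rightarrow> 'r set \<Rightarrow> bool"
  where "is_ideal_of C J \<longleftrightarrow> J \<subseteq> C \<and> 0 \<in> J \<and> (\<forall>p\<in>J. \<forall>q\<in>J. p + q \<in> J) \<and> (\<forall>c\<in>C. \<forall>p\<in>J. c * p \<in> J)"

text \<open>A ring homomorphism \<open>\<eta>\<close> makes A a K-algebra.\<close>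

definition algebra_map :: "('k::field \<Rightarrow> 'a::comm_ring_1) \<Rightarrow> bool"
  where "algebra_map \<eta> \<longleftrightarrow> \<eta> 1 = 1 \<and> (\<forall>c c'. \<eta> (c + c') = \<eta> c + \<eta> c' \<and> \<eta> (c * c') = \<eta> c * \<eta> c')"

text \<open>A-valued points of the spectrum of C: the homomorphisms of K-algebras from C to A.\<close>

definition spec_points ::
    "('k \<Rightarrow> 'a) \<Rightarrow> 'k::field coord_poly set \<Rightarrow> ('k coord_poly \<Rightarrow> 'a::comm_ring_1) set"
  where "spec_points \<eta> C = {\<phi>. (\<forall>c. \<phi> (const c) = \<eta> c) \<and>
    (\<forall>p\<in>C. \<forall>q\<in>C. \<phi> (p + q) = \<phi> p + \<phi> q \<and> \<phi> (p * q) = \<phi> p * \<phi> q)}"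

text \<open>The ideals of A[x,y] which a point classifies: the pullbacks of the universal families.\<close>

definition fam_pos ::
    "nat \<Rightarrow> nat \<Rightarrow> 'k::field poly2 set \<Rightarrow> ('k coord_poly \<Rightarrow> 'a::comm_ring_1) \<Rightarrow> 'a poly2 set"
  where "fam_pos \<alpha> \<beta> M \<phi> = ideal_gen
    {Poly_Mapping.map \<phi> (fam lex (r_exp \<alpha> \<beta>) (Mons M) (\<lambda>c. var (Inl c)) i) | i.
      i < length (gens lex (Mons M))}"

definition fam_neg ::
    "nat \<Rightarrow> nat \<Rightarrow> 'k::field poly2 set \<Rightarrow> ('k coord_poly \<Rightarrow> 'a::comm_ring_1) \<Rightarrow> 'a poly2 set"
  where "fam_neg \<alpha> \<beta> N \<phi> = ideal_gen
    {Poly_Mapping.map \<phi> (fam lex_opp (r_exp_opp \<alpha> \<beta>) (Mons N) (\<lambda>c. var (Inr c)) k) | k.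
      k < length (gens lex_opp (Mons N))}"

text \<open>
  J defines the edge-scheme inside Spec of the coordinate ring, tested on A-valued points.
  By Yoneda's lemma, holding for all K-algebras A determines J.
\<close>

definition defines_edge_scheme ::
    "nat \<Rightarrow> nat \<Rightarrow> (nat \<Rightarrow> nat) \<Rightarrow> 'k::field poly2 set \<Rightarrow> 'k poly2 set \<Rightarrow>
      ('k \<Rightarrow> 'a::comm_ring_1) \<Rightarrow> 'k coord_poly set \<Rightarrow> bool"
  where "defines_edge_scheme \<alpha> \<beta> H M N \<eta> J \<longleftrightarrow>
    is_ideal_of (coord_ring \<alpha> \<beta> M N) J \<and>
    {\<phi> \<in> spec_points \<eta> (coord_ring \<alpha> \<beta> M N). \<forall>p\<in>J. \<phi> p = 0} =
    {\<phi> \<in> spec_points \<eta> (coord_ring \<alpha> \<beta> M N).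
      (fam_pos \<alpha> \<beta> M \<phi>, fam_neg \<alpha> \<beta> N \<phi>) \<in> edge_points \<alpha> \<beta> H \<eta> M N}"

section \<open>Paths, walks, strolls and hikes\<close>

type_synonym path = "arrow list"
type_synonym walk = "path list"
type_synonym stroll = "walk list"

inductive is_path :: "(mon \<Rightarrow> mon \<Rightarrow> bool) \<Rightarrow> int \<times> int \<Rightarrow> mon set \<Rightarrow> nat \<Rightarrow> path \<Rightarrow> bool"
  for lt \<rho> S
  where
    single: "\<lbrakk>1 \<le> i; i < length (gens lt S); (gens lt S ! i, l) \<in> sig_arrows lt \<rho> S\<rbrakk> \<Longrightarrow>
      is_path lt \<rho> S i [(gens lt S ! i, l)]"
  | down: "\<lbrakk>1 \<le> i; i < length (gens lt S); is_path lt \<rho> S (i - 1) P\<rbrakk> \<Longrightarrow> is_path lt \<rho> S i P"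
  | step: "\<lbrakk>1 \<le> i; i < length (gens lt S); (gens lt S ! i, l) \<in> sig_arrows lt \<rho> S;
      rmul \<rho> l (wlcm lt S i) = Some w; is_path lt \<rho> S (jmax lt S w) P\<rbrakk> \<Longrightarrow>
      is_path lt \<rho> S i ((gens lt S ! i, l) # P)"

definition path_len :: "path \<Rightarrow> nat"
  where "path_len P = sum_list (map snd P)"

definition path_coeff :: "(arrow \<Rightarrow> 'r::comm_ring_1) \<Rightarrow> path \<Rightarrow> 'r"
  where "path_coeff X P = prod_list (map X P)"

definition walk_len :: "walk \<Rightarrow> nat"
  where "walk_len W = sum_list (map path_len W)"

definition walk_coeff :: "(arrow \<Rightarrow> 'r::comm_ring_1) \<Rightarrow> walk \<Rightarrow> 'r"
  where "walk_coeff X W = (- 1) ^ (length W + 1) * prod_list (map (path_coeff X) W)"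

definition stroll_len :: "stroll \<Rightarrow> nat"
  where "stroll_len Q = sum_list (map walk_len Q)"

definition stroll_coeff :: "(arrow \<Rightarrow> 'r::comm_ring_1) \<Rightarrow> stroll \<Rightarrow> 'r"
  where "stroll_coeff X Q = (- 1) ^ length Q * prod_list (map (walk_coeff X) Q)"

definition is_walk ::
    "(mon \<Rightarrow> mon \<Rightarrow> bool) \<Rightarrow> int \<times> int \<Rightarrow> mon set \<Rightarrow> nat \<Rightarrow> mon \<Rightarrow> walk \<Rightarrow> bool"
  where "is_walk lt \<rho> S i s W \<longleftrightarrow>
    W \<noteq> [] \<and> is_path lt \<rho> S i (W ! 0) \<and>
    (\<forall>k. 1 \<le> k \<and> k < length W \<longrightarrow>
      (\<exists>m. rmul \<rho> (walk_len (take k W)) (gens lt S ! i) = Some m \<and> m \<in> S \<and>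
        is_path lt \<rho> S (jmax lt S m) (W ! k))) \<and>
    rmul \<rho> (walk_len W) (gens lt S ! i) = Some s"

text \<open>The empty list encodes the trivial stroll; its length is 0 and its coefficient is 1.\<close>

definition is_stroll ::
    "(mon \<Rightarrow> mon \<Rightarrow> bool) \<Rightarrow> int \<times> int \<Rightarrow> mon set \<Rightarrow> mon \<Rightarrow> mon \<Rightarrow> stroll \<Rightarrow> bool"
  where "is_stroll lt \<rho> S m s Q \<longleftrightarrow>
    (m \<notin> S \<and> s = m \<and> Q = []) \<or>
    (m \<in> S \<and> s \<notin> S \<and> Q \<noteq> [] \<and>
      (\<forall>k < length Q. \<exists>m'. rmul \<rho> (stroll_len (take k Q)) m = Some m' \<and> m' \<in> S \<and>
        (\<exists>t. t \<notin> S \<and> is_walk lt \<rho> S (jmax lt S m') t (Q ! k))) \<and>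
      rmul \<rho> (stroll_len Q) m = Some s)"

text \<open>In a hike the empty path encodes the arrow of length zero.\<close>

definition hikes ::
    "nat \<Rightarrow> nat \<Rightarrow> 'k::field poly2 set \<Rightarrow> 'k poly2 set \<Rightarrow> mon \<Rightarrow> mon \<Rightarrow> (path \<times> stroll) set"
  where "hikes \<alpha> \<beta> M N n s = {(P, Q). \<exists>m.
    ((P = [] \<and> m = n) \<or>
     (\<exists>k < length (gens lex_opp (Mons N)). gens lex_opp (Mons N) ! k = n \<and>
        is_path lex_opp (r_exp_opp \<alpha> \<beta>) (Mons N) k P \<and>
        rmul (r_exp_opp \<alpha> \<beta>) (path_len P) n = Some m \<and> lex n m)) \<and>
    is_stroll lex (r_exp \<alpha> \<beta>) (Mons M) m s Q}"

definition hike_coeff :: "path \<times> stroll \<Rightarrow> 'k::field coord_poly"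
  where "hike_coeff h =
    path_coeff (\<lambda>c. var (Inr c)) (fst h) * stroll_coeff (\<lambda>c. var (Inl c)) (snd h)"

definition edge_eq ::
    "nat \<Rightarrow> nat \<Rightarrow> 'k::field poly2 set \<Rightarrow> 'k poly2 set \<Rightarrow> mon \<Rightarrow> mon \<Rightarrow> 'k coord_poly"
  where "edge_eq \<alpha> \<beta> M N n s = (\<Sum>h \<in> hikes \<alpha> \<beta> M N n s. hike_coeff h)"

definition edge_ideal ::
    "nat \<Rightarrow> nat \<Rightarrow> 'k::field poly2 set \<Rightarrow> 'k poly2 set \<Rightarrow> 'k coord_poly set"
  where "edge_ideal \<alpha> \<beta> M N = is_ideal_of (coord_ring \<alpha> \<beta> M N) hull
    {edge_eq \<alpha> \<beta> M N n s | n s.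
      n \<in> min_gens (Mons N) \<and> s \<notin> Mons M \<and> mdeg \<alpha> \<beta> n = mdeg \<alpha> \<beta> s}"

end

theory Submission
  imports "Jordan_Normal_Form.Determinant" Defs
begin

text \<open>
  A point \<open>\<phi>\<close> of the coordinate ring with values in a K-algebra A specialises the two universal
  families to ideals \<open>I_pos\<close> and \<open>I_neg\<close> of A[x,y], and the edge-scheme is the locus where the two
  agree.  So the claim is that \<open>I_pos = I_neg\<close> exactly when \<open>\<phi>\<close> kills all edge equations.

  The first ingredient is that the \<open>f_i\<close> are a Groebner basis with initial ideal M over every
  ring A (lemmas \<open>fam_ideal_eq_rep_span\<close> and \<open>init_ideal_fam_ideal\<close>).  The recursion that defines
  \<open>f_i\<close>, multiplied by \<open>w_i / m_i\<close>, expresses the S-polynomial of \<open>f_{i-1}\<close> and \<open>f_i\<close> by multiples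
  of the \<open>f_j\<close> with smaller leading monomials.  Instead of a Buchberger criterion over A, this
  relation is used to see that the A-span of the elements \<open>(m / m_j) f_j\<close>, with \<open>j = j(m)\<close> and one
  for each m in M, is closed under multiplication by x and by y; hence it is the whole ideal, and
  its elements have their leading monomials in M.  So the standard monomials of M are a basis
  modulo \<open>I_pos\<close>, and \<open>I_pos\<close> is a point of the cell of M; likewise for N.

  The second ingredient identifies the combinatorial sums.  Unfolding the recursion shows
  that \<open>f_i\<close> is the sum over the paths from \<open>m_i\<close> (lemma \<open>fam_eq_pathsum\<close>).  Replacing a monomial
  m of M by minus the tail of \<open>(m / m_j) f_j\<close>, as often as possible, reduces \<open>m_j\<close> along walks;
  replacing m by minus the tail of the multiple of the reduced generator reduces m along strolls
  (lemma \<open>normal_form_congruent\<close>).  Hence the hikes from a generator n of N to s compute the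
  coefficient of s in the normal form modulo \<open>I_pos\<close> of the generator of \<open>I_neg\<close> that belongs to n
  (lemma \<open>lookup_remainder\<close>), and the edge equations vanish at \<open>\<phi>\<close> if and only if \<open>I_neg\<close> is
  contained in \<open>I_pos\<close>.

  Finally the containment is an equality: in each degree it gives a surjection between free
  modules of the same rank \<open>H(d)\<close>, and over a commutative ring such a map is injective because a
  one-sided inverse of a square matrix is two-sided.
\<close>

hide_const (open) Polynomial.monom

section \<open>One-sided inverses of square matrices\<close>

text \<open>
  From \<open>P Q = 1\<close> the determinants are units; multiplying \<open>P Q = 1\<close> by the adjugate of P gives
  \<open>adj P = det P \<cdot> Q\<close>, and then \<open>adj P \<cdot> P = det P\<close> yields \<open>Q P = 1\<close>.
\<close>

lemma square_right_inverse_imp_left_inverse: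
  fixes P Q :: "nat \<Rightarrow> nat \<Rightarrow> 'a::comm_ring_1"
  assumes PQ: "\<And>i k. i < h \<Longrightarrow> k < h \<Longrightarrow> (\<Sum>j<h. P i j * Q j k) = of_bool (i = k)"
    and "i < h" "k < h"
  shows "(\<Sum>j<h. Q i j * P j k) = of_bool (i = k)"
proof -
  define A where "A = mat h h (\<lambda>(i, j). P i j)"
  define B where "B = mat h h (\<lambda>(i, j). Q i j)"
  have A: "A \<in> carrier_mat h h" and B: "B \<in> carrier_mat h h"
    by (simp_all add: A_def B_def)
  have AB: "A * B = 1\<^sub>m h"
    by (rule eq_matI) (auto simp: A_def B_def scalar_prod_def PQ atLeast0LessThan)
  have det: "det B * det A = 1"
    using det_mult[OF A B] by (simp add: AB mult.commute)
  have adj: "adj_mat A \<in> carrier_mat h h" "adj_mat A * A = det A \<cdot>\<^sub>m 1\<^sub>m h"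
    using adj_mat[OF A] by auto
  have "adj_mat A = adj_mat A * (A * B)" using adj AB by simp
  also have "\<dots> = (adj_mat A * A) * B" using adj(1) A B by simp
  also have "\<dots> = det A \<cdot>\<^sub>m B"
    using B by (simp add: adj(2) mult_smult_assoc_mat[of _ h h _ h])
  finally have "adj_mat A = det A \<cdot>\<^sub>m B" .
  hence "det A \<cdot>\<^sub>m (B * A) = det A \<cdot>\<^sub>m 1\<^sub>m h"
    using adj(2) A B by (simp add: mult_smult_assoc_mat[of _ h h _ h])
  hence "det B \<cdot>\<^sub>m (det A \<cdot>\<^sub>m (B * A)) = det B \<cdot>\<^sub>m (det A \<cdot>\<^sub>m 1\<^sub>m h)" by simp
  moreover have "det B \<cdot>\<^sub>m (det A \<cdot>\<^sub>m X) = X" if "X \<in> carrier_mat h h" for X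
    using that by (intro eq_matI) (auto simp: det mult.assoc[symmetric])
  ultimately have "B * A = 1\<^sub>m h" using A B by simp
  hence "(B * A) $$ (i, k) = of_bool (i = k)" using assms by simp
  thus ?thesis using assms by (simp add: A_def B_def scalar_prod_def atLeast0LessThan)
qed

text \<open>
  If \<open>h' < h\<close>, padding by zeros makes both matrices square of size h, and the product in the other
  order then has a zero row where the unit matrix has none.
\<close>

lemma right_inverse_imp_rank_le:
  fixes P Q :: "nat \<Rightarrow> nat \<Rightarrow> 'a::comm_ring_1"
  assumes PQ: "\<And>i k. i < h \<Longrightarrow> k < h \<Longrightarrow> (\<Sum>j<h'. P i j * Q j k) = of_bool (i = k)"
  shows "h \<le> h'"
proof (rule ccontr)
  assume "\<not> h \<le> h'"
  define P' where "P' i j = (if j < h' then P i j else 0)" for i j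
  define Q' where "Q' j k = (if j < h' then Q j k else 0)" for j k
  have "(\<Sum>j<h. P' i j * Q' j k) = (\<Sum>j<h'. P i j * Q j k)" for i k
    using \<open>\<not> h \<le> h'\<close> by (intro sum.mono_neutral_cong_right) (auto simp: P'_def Q'_def)
  hence P'Q': "(\<Sum>j<h. P' i j * Q' j k) = of_bool (i = k)" if "i < h" "k < h" for i k
    using PQ[OF that] by simp
  have "(\<Sum>j<h. Q' h' j * P' j h') = of_bool (h' = h')"
    by (rule square_right_inverse_imp_left_inverse[of h P' Q', OF P'Q'])
       (use \<open>\<not> h \<le> h'\<close> in simp_all)
  thus False by (simp add: Q'_def)
qed

section \<open>Polynomials\<close>

interpretation idl: Modules.module "(*) :: 'r::comm_ring_1 \<Rightarrow> 'r \<Rightarrow> 'r"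
  by unfold_locales (simp_all add: algebra_simps)

(* As a rewrite rule this is associativity in the direction opposite to mult.assoc. *)
declare idl.scale_scale [simp del]

lemma const_0 [simp]: "const 0 = 0"
  and const_1 [simp]: "const 1 = 1"
  by (simp_all add: const_def)

lemma const_add: "const (a + b) = const a + const b"
  and const_mult: "const (a * b) = const a * const b"
  and const_uminus: "const (- a) = - const a"
  by (simp_all add: const_def single_add mult_single single_uminus)

lemma const_sum: "const (sum f F) = (\<Sum>x\<in>F. const (f x))"
  by (induction F rule: infinite_finite_induct) (simp_all add: const_add)

interpretation lin: Modules.module "\<lambda>(c::'a::comm_ring_1) (f :: 'm::comm_monoid_add \<Rightarrow>\<^sub>0 'a). const c * f"
  by unfold_locales (simp_all add: ring_distribs const_add const_mult mult.assoc)

declare lin.scale_scale [simp del]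

lemma monom_mult: "monom m * monom m' = monom (m + m')"
  by (simp add: monom_def mult_single)

lemma lookup_monom: "Poly_Mapping.lookup (monom m) k = of_bool (k = m)"
  by (simp add: monom_def lookup_single when_def)

lemma lookup_const_mult [simp]:
  "Poly_Mapping.lookup (const c * f) k = c * Poly_Mapping.lookup f k"
  for f :: "'m::comm_monoid_add \<Rightarrow>\<^sub>0 'a::comm_ring_1"
  unfolding const_def mult_map_scale_conv_mult[symmetric] by (simp add: map.rep_eq when_def)

lemma poly_eq_sum_monom:
  fixes f :: "'m::comm_monoid_add \<Rightarrow>\<^sub>0 'a::comm_ring_1"
  shows "f = (\<Sum>m\<in>Poly_Mapping.keys f. const (Poly_Mapping.lookup f m) * monom m)"
  by (rule poly_mapping_eqI)
     (auto simp: lookup_sum lookup_monom of_bool_def in_keys_iff sum.delta if_distrib cong: if_cong)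

lemma lookup_monom_mult:
  fixes d :: mon and f :: "'a::comm_ring_1 poly2"
  shows "Poly_Mapping.lookup (monom d * f) (d + m) = Poly_Mapping.lookup f m"
proof -
  have "monom d * f = (\<Sum>k\<in>Poly_Mapping.keys f. const (Poly_Mapping.lookup f k) * monom (d + k))"
    by (subst poly_eq_sum_monom[of f])
       (simp add: sum_distrib_left mult.left_commute flip: monom_mult)
  thus ?thesis
    by (auto simp: lookup_sum lookup_monom of_bool_def in_keys_iff sum.delta if_distrib cong: if_cong)
qed

lemma monom_mult_cancel:
  fixes d :: mon and f g :: "'a::comm_ring_1 poly2"
  assumes "monom d * f = monom d * g"
  shows "f = g"
  by (rule poly_mapping_eqI) (metis assms lookup_monom_mult)

lemma mon_frac_eq:
  fixes d m :: mon and f g :: "'a::comm_ring_1 poly2"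
  assumes "monom d * g = monom m * f"
  shows "mon_frac m d f = g"
  unfolding mon_frac_def
proof (rule the_equality)
  show "g' = g" if "monom d * g' = monom m * f" for g'
    by (rule monom_mult_cancel[of d]) (simp only: that assms)
qed (rule assms)

text \<open>
  This reduces the ideal property of a submodule to multiplication by monomials, which is how both
  monomial ideals and the span of the reducing elements are handled below.
\<close>

lemma ideal_monom_mult_closedI:
  fixes L :: "'a::comm_ring_1 poly2 set"
  assumes "module.subspace (\<lambda>c f. const c * f) L"
    and "\<And>f m. f \<in> L \<Longrightarrow> monom m * f \<in> L"
  shows "is_ideal L"
proof (rule idl.subspaceI)
  fix p f assume "f \<in> L"
  have "p * f = (\<Sum>m\<in>Poly_Mapping.keys p. const (Poly_Mapping.lookup p m) * (monom m * f))"
    by (subst poly_eq_sum_monom[of p]) (simp add: sum_distrib_right mult.assoc)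
  thus "p * f \<in> L"
    using assms \<open>f \<in> L\<close> by (simp add: lin.subspace_sum lin.subspace_scale)
qed (use assms lin.subspace_0 lin.subspace_add in auto)

lemma subspace_if_ideal:
  fixes L :: "('m::comm_monoid_add \<Rightarrow>\<^sub>0 'a::comm_ring_1) set"
  assumes "is_ideal L"
  shows "module.subspace (\<lambda>c f. const c * f) L"
  using assms by (intro lin.subspaceI) (auto simp: idl.subspace_0 idl.subspace_add idl.subspace_scale)

section \<open>Polynomials supported on a set of monomials\<close>

definition supported :: "'m set \<Rightarrow> ('m::comm_monoid_add \<Rightarrow>\<^sub>0 'a::comm_ring_1) set"
  where "supported U = {f. Poly_Mapping.keys f \<subseteq> U}"

lemma supported_iff: "f \<in> supported U \<longleftrightarrow> (\<forall>m. m \<notin> U \<longrightarrow> Poly_Mapping.lookup f m = 0)"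
  by (auto simp: supported_def in_keys_iff)

lemma supported_monom: "m \<in> U \<Longrightarrow> monom m \<in> supported U"
  by (auto simp: supported_iff lookup_monom)

lemma supported_subspace: "module.subspace (\<lambda>c f. const c * f) (supported U)"
  by (intro lin.subspaceI) (auto simp: supported_iff lookup_add)

lemma supported_eq_span:
  fixes U :: "'m::comm_monoid_add set"
  shows "(supported U :: ('m \<Rightarrow>\<^sub>0 'a::comm_ring_1) set) =
    module.span (\<lambda>c f. const c * f) (monom ` U)"
proof
  show "(supported U :: ('m \<Rightarrow>\<^sub>0 'a) set) \<subseteq> module.span (\<lambda>c f. const c * f) (monom ` U)"
  proof
    fix f :: "'m \<Rightarrow>\<^sub>0 'a" assume "f \<in> supported U"
    hence "(\<Sum>m\<in>Poly_Mapping.keys f. const (Poly_Mapping.lookup f m) * monom m)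
        \<in> module.span (\<lambda>c f. const c * f) (monom ` U)"
      by (intro lin.span_sum lin.span_scale lin.span_base) (auto simp: supported_def)
    thus "f \<in> module.span (\<lambda>c f. const c * f) (monom ` U)"
      by (simp flip: poly_eq_sum_monom)
  qed
  show "module.span (\<lambda>c f. const c * f) (monom ` U) \<subseteq> (supported U :: ('m \<Rightarrow>\<^sub>0 'a) set)"
    by (intro lin.span_minimal supported_subspace) (auto intro: supported_monom)
qed

lemma supported_ideal:
  assumes "\<And>m d. m \<in> U \<Longrightarrow> d + m \<in> U"
  shows "is_ideal (supported U :: 'a::comm_ring_1 poly2 set)"
proof (rule ideal_monom_mult_closedI[OF supported_subspace])
  fix f :: "'a poly2" and d assume "f \<in> supported U"
  thus "monom d * f \<in> supported U"
    unfolding supported_eq_span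
  proof (induction rule: lin.span_induct_alt)
    case base thus ?case by (simp add: lin.span_zero)
  next
    case (step c x y)
    then obtain m where m: "m \<in> U" "x = monom m" by auto
    have "monom d * (const c * x + y) = const c * monom (d + m) + monom d * y"
      by (simp add: m algebra_simps flip: monom_mult)
    moreover have "monom (d + m) \<in> module.span (\<lambda>c f. const c * f) (monom ` U :: 'a poly2 set)"
      using assms m by (intro lin.span_base imageI)
    ultimately show ?case using step.IH by (simp add: lin.span_add lin.span_scale)
  qed
qed

lemma supported_subset_ideal:
  fixes I :: "('m::comm_monoid_add \<Rightarrow>\<^sub>0 'a::comm_ring_1) set"
  assumes "is_ideal I" "\<And>m. m \<in> U \<Longrightarrow> monom m \<in> I"
  shows "supported U \<subseteq> I"
  unfolding supported_eq_span using assms by (intro lin.span_minimal subspace_if_ideal) auto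

lemma homog_iff_supported: "homog \<alpha> \<beta> d f \<longleftrightarrow> f \<in> supported {m. mdeg \<alpha> \<beta> m = d}"
  by (auto simp: homog_def supported_def)

lemma Mons_closed:
  fixes M :: "'a::comm_ring_1 poly2 set"
  assumes "is_ideal M" "m \<in> Mons M"
  shows "d + m \<in> Mons M"
  using idl.subspace_scale[OF assms(1), of "monom m" "monom d"] assms(2)
  by (simp add: Mons_def monom_mult)

lemma monomial_ideal_eq_supported:
  fixes M :: "'a::comm_ring_1 poly2 set"
  assumes "monomial_ideal M"
  shows "is_ideal M" "M = supported (Mons M)"
proof -
  obtain S where S: "M = ideal_gen (monom ` S)"
    using assms unfolding monomial_ideal_def by blast
  show M: "is_ideal M" unfolding S by (rule idl.subspace_span)
  have "monom s \<in> M" if "s \<in> S" for s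
    unfolding S using that by (intro idl.span_base imageI)
  hence "S \<subseteq> Mons M" by (auto simp: Mons_def)
  hence "ideal_gen (monom ` S) \<subseteq> supported (Mons M :: mon set)"
    by (intro idl.span_minimal supported_ideal Mons_closed M) (auto intro: supported_monom)
  moreover have "supported (Mons M) \<subseteq> M"
    using M by (rule supported_subset_ideal) (simp add: Mons_def)
  ultimately show "M = supported (Mons M)" using S by auto
qed

text \<open>
  Over both K and A an ideal generated by monomials is determined by the monomials that it
  contains, so base change of M only changes the coefficients.
\<close>

lemma extend_monomial_ideal:
  fixes M :: "'k::field poly2 set" and \<eta> :: "'k \<Rightarrow> 'a::comm_ring_1"
  assumes "monomial_ideal M" "\<eta> 0 = 0" "\<eta> 1 = 1"
  shows "extend_ideal \<eta> M = supported (Mons M)"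
proof
  note M = monomial_ideal_eq_supported[OF assms(1)]
  show "extend_ideal \<eta> M \<subseteq> supported (Mons M)"
    unfolding extend_ideal_def
  proof (intro idl.span_minimal supported_ideal Mons_closed M(1) subsetI)
    fix g assume "g \<in> Poly_Mapping.map \<eta> ` M"
    then obtain f where "f \<in> supported (Mons M)" "g = Poly_Mapping.map \<eta> f"
      using M(2) by auto
    thus "g \<in> supported (Mons M)" by (auto simp: supported_iff map.rep_eq)
  qed
  have "monom m \<in> extend_ideal \<eta> M" if "m \<in> Mons M" for m
  proof -
    have "Poly_Mapping.map \<eta> (monom m) = monom m"
      by (simp add: monom_def assms)
    moreover have "monom m \<in> M" using that by (simp add: Mons_def)
    ultimately show ?thesis unfolding extend_ideal_def by (metis idl.span_base imageI)
  qed
  thus "supported (Mons M) \<subseteq> extend_ideal \<eta> M"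
    by (intro supported_subset_ideal) (auto simp: extend_ideal_def)
qed

section \<open>Bases of the graded pieces of a quotient\<close>

lemma quot_basis_1:
  assumes "quot_basis \<alpha> \<beta> 1 I d h e"
  shows "i < h \<Longrightarrow> homog \<alpha> \<beta> d (e i)"
    and "homog \<alpha> \<beta> d f \<Longrightarrow> \<exists>c. f - (\<Sum>i<h. const (c i) * e i) \<in> I"
    and "(\<Sum>i<h. const (c i) * e i) \<in> I \<Longrightarrow> i < h \<Longrightarrow> c i = 0"
  using assms by (auto simp: quot_basis_def)

text \<open>
  P and Q are the transition matrices between two bases in one degree.  The inclusion of the ideals
  allows the relations modulo the smaller one to be substituted into those modulo the larger one, so
  one of the two products is the unit matrix.
\<close>

lemma quot_basis_change:
  fixes e e' :: "nat \<Rightarrow> 'a::comm_ring_1 poly2"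
  assumes e: "quot_basis \<alpha> \<beta> 1 I d h e" and e': "quot_basis \<alpha> \<beta> 1 I' d h' e'"
    and I: "is_ideal I" "is_ideal I'" "I' \<subseteq> I"
  shows "\<exists>P Q. (\<forall>i<h. \<forall>k<h. (\<Sum>j<h'. P i j * Q j k) = of_bool (i = k)) \<and>
    (\<forall>i<h'. e' i - (\<Sum>j<h. const (Q i j) * e j) \<in> I)"
proof -
  have "\<forall>i\<in>{..<h}. \<exists>c. e i - (\<Sum>j<h'. const (c j) * e' j) \<in> I'"
    using quot_basis_1(1)[OF e] by (auto intro: quot_basis_1(2)[OF e'])
  then obtain P where P: "\<And>i. i < h \<Longrightarrow> e i - (\<Sum>j<h'. const (P i j) * e' j) \<in> I'"
    by (subst (asm) bchoice_iff) auto
  have "\<forall>i\<in>{..<h'}. \<exists>c. e' i - (\<Sum>j<h. const (c j) * e j) \<in> I"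
    using quot_basis_1(1)[OF e'] by (auto intro: quot_basis_1(2)[OF e])
  then obtain Q where Q: "\<And>i. i < h' \<Longrightarrow> e' i - (\<Sum>j<h. const (Q i j) * e j) \<in> I"
    by (subst (asm) bchoice_iff) auto
  have "(\<Sum>j<h'. P i j * Q j k) = of_bool (i = k)" if ik: "i < h" "k < h" for i k
  proof -
    (* Expressing e i by the e' j and these again by the e k leaves a relation among the e k. *)
    define c where "c k = of_bool (i = k) - (\<Sum>j<h'. P i j * Q j k)" for k
    have "(\<Sum>k<h. const (of_bool (i = k)) * e k) = (\<Sum>k<h. if k = i then e k else 0)"
      by (intro sum.cong) auto
    hence "(\<Sum>k<h. const (of_bool (i = k)) * e k) = e i"
      using ik by simp
    moreover have "(\<Sum>k<h. const (\<Sum>j<h'. P i j * Q j k) * e k) =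
        (\<Sum>j<h'. const (P i j) * (\<Sum>k<h. const (Q j k) * e k))"
      by (simp add: const_sum const_mult sum_distrib_left sum_distrib_right mult.assoc)
         (rule sum.swap)
    ultimately have "(\<Sum>k<h. const (c k) * e k) =
        (e i - (\<Sum>j<h'. const (P i j) * e' j)) +
        (\<Sum>j<h'. const (P i j) * (e' j - (\<Sum>k<h. const (Q j k) * e k)))"
      by (simp add: c_def const_add const_uminus diff_conv_add_uminus sum.distrib sum_negf
          ring_distribs del: add_uminus_conv_diff)
    moreover have "e i - (\<Sum>j<h'. const (P i j) * e' j) \<in> I" using P ik I by blast
    moreover have "(\<Sum>j<h'. const (P i j) * (e' j - (\<Sum>k<h. const (Q j k) * e k))) \<in> I"
      using Q by (intro idl.subspace_sum idl.subspace_scale I) auto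
    ultimately have "(\<Sum>k<h. const (c k) * e k) \<in> I" by (simp add: idl.subspace_add I)
    hence "c k = 0" using ik by (intro quot_basis_1(3)[OF e])
    thus ?thesis by (simp add: c_def)
  qed
  thus ?thesis using Q by (intro exI[of _ P] exI[of _ Q]) simp
qed

lemma quot_basis_card_unique:
  fixes e e' :: "nat \<Rightarrow> 'a::comm_ring_1 poly2"
  assumes e: "quot_basis \<alpha> \<beta> 1 I d h e" and e': "quot_basis \<alpha> \<beta> 1 I d h' e'"
    and I: "is_ideal I"
  shows "h = h'"
proof (rule antisym)
  show "h \<le> h'"
    using quot_basis_change[OF e e' I I subset_refl] by (auto intro: right_inverse_imp_rank_le)
  show "h' \<le> h"
    using quot_basis_change[OF e' e I I subset_refl] by (auto intro: right_inverse_imp_rank_le)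
qed

text \<open>
  The surjection from the quotient by \<open>I'\<close> to the quotient by I has a square matrix Q with left
  inverse P.  By the determinant argument P is also a right inverse, so the map is injective and f
  vanishes in the quotient by \<open>I'\<close> already.
\<close>

lemma same_rank_inclusion_eq:
  fixes e e' :: "nat \<Rightarrow> 'a::comm_ring_1 poly2"
  assumes e: "quot_basis \<alpha> \<beta> 1 I d h e" and e': "quot_basis \<alpha> \<beta> 1 I' d h e'"
    and I: "is_ideal I" "is_ideal I'" "I' \<subseteq> I"
    and f: "f \<in> I" "homog \<alpha> \<beta> d f"
  shows "f \<in> I'"
proof -
  obtain P Q where "\<forall>i<h. \<forall>k<h. (\<Sum>j<h. P i j * Q j k) = of_bool (i = k)"
    and Q: "\<forall>i<h. e' i - (\<Sum>j<h. const (Q i j) * e j) \<in> I"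
    using quot_basis_change[OF e e' I] by (elim exE conjE)
  hence PQ: "\<And>i k. i < h \<Longrightarrow> k < h \<Longrightarrow> (\<Sum>j<h. P i j * Q j k) = of_bool (i = k)"
    by simp
  obtain c where c: "f - (\<Sum>i<h. const (c i) * e' i) \<in> I'"
    using quot_basis_1(2)[OF e' f(2)] by blast
  have "const (c i) * (e' i - (\<Sum>j<h. const (Q i j) * e j)) \<in> I" if "i < h" for i
    using Q I that by (simp add: idl.subspace_scale)
  hence "(\<Sum>i<h. const (c i) * (e' i - (\<Sum>j<h. const (Q i j) * e j))) \<in> I"
    by (intro idl.subspace_sum I) simp
  moreover have "f - (f - (\<Sum>i<h. const (c i) * e' i)) \<in> I"
    using idl.subspace_diff[OF I(1) f(1)] c I(3) by blast
  ultimately have "f - (f - (\<Sum>i<h. const (c i) * e' i)) -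
      (\<Sum>i<h. const (c i) * (e' i - (\<Sum>j<h. const (Q i j) * e j))) \<in> I"
    by (rule idl.subspace_diff[OF I(1), rotated])
  also have "f - (f - (\<Sum>i<h. const (c i) * e' i)) - 
      (\<Sum>i<h. const (c i) * (e' i - (\<Sum>j<h. const (Q i j) * e j))) =
      (\<Sum>i<h. const (c i) * (\<Sum>j<h. const (Q i j) * e j))"
    by (simp add: algebra_simps sum_subtractf)
  also have "\<dots> = (\<Sum>j<h. const (\<Sum>i<h. c i * Q i j) * e j)"
    by (simp add: const_sum const_mult sum_distrib_left sum_distrib_right mult.assoc)
       (rule sum.swap)
  finally have "(\<Sum>j<h. const (\<Sum>i<h. c i * Q i j) * e j) \<in> I" .
  hence cQ: "(\<Sum>i<h. c i * Q i j) = 0" if "j < h" for j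
    using quot_basis_1(3)[OF e, of "\<lambda>j. \<Sum>i<h. c i * Q i j" j] that by simp
  have "c k = 0" if k: "k < h" for k
  proof -
    have "c k = (\<Sum>i<h. c i * of_bool (i = k))"
      using k by (simp add: of_bool_def if_distrib cong: if_cong)
    also have "\<dots> = (\<Sum>i<h. c i * (\<Sum>j<h. Q i j * P j k))"
      using square_right_inverse_imp_left_inverse[of h P Q, OF PQ] k by (intro sum.cong) auto
    also have "\<dots> = (\<Sum>j<h. (\<Sum>i<h. c i * Q i j) * P j k)"
      by (simp add: sum_distrib_left sum_distrib_right mult.assoc) (rule sum.swap)
    also have "\<dots> = 0" using cQ by simp
    finally show ?thesis .
  qed
  thus ?thesis using c by simp
qed

lemma finite_mdeg: 
  assumes "0 < \<alpha>" "0 < \<beta>"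
  shows "finite {m. mdeg \<alpha> \<beta> m = d}"
proof (rule finite_subset)
  show "{m. mdeg \<alpha> \<beta> m = d} \<subseteq> {..d} \<times> {..d}"
  proof safe
    fix a b
    have "a \<le> \<alpha> * a" "b \<le> \<beta> * b" using assms by simp_all
    thus "a \<le> mdeg \<alpha> \<beta> (a, b)" "b \<le> mdeg \<alpha> \<beta> (a, b)"
      unfolding mdeg_def fst_conv snd_conv by linarith+
  qed
qed simp

lemma standard_monomials_quot_basis:
  fixes I :: "'a::comm_ring_1 poly2 set"
  assumes "0 < \<alpha>" "0 < \<beta>"
    and span: "\<And>f. homog \<alpha> \<beta> d f \<Longrightarrow> \<exists>q. q \<in> supported (- S) \<and> homog \<alpha> \<beta> d q \<and> f - q \<in> I"
    and indep: "\<And>q. q \<in> I \<Longrightarrow> q \<in> supported (- S) \<Longrightarrow> q = 0"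
  shows "\<exists>e. quot_basis \<alpha> \<beta> 1 I d (card {s. s \<notin> S \<and> mdeg \<alpha> \<beta> s = d}) e"
proof -
  define D where "D = {s. s \<notin> S \<and> mdeg \<alpha> \<beta> s = d}"
  have "finite D" unfolding D_def using finite_mdeg[OF assms(1,2), of d] by (rule rev_finite_subset) auto
  then obtain b where b: "bij_betw b {..<card D} D"
    using ex_bij_betw_nat_finite[of D] by (auto simp: atLeast0LessThan)
  define e where "e i = (monom (b i) :: 'a poly2)" for i
  have bD: "b i \<in> D" if "i < card D" for i
    using bij_betwE[OF b] that by auto
  have inj: "inj_on b {..<card D}" using b by (simp add: bij_betw_def)
  have "quot_basis \<alpha> \<beta> 1 I d (card D) e"
    unfolding quot_basis_def
  proof (intro conjI allI impI)
    fix i assume "i < card D"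
    thus "homog \<alpha> \<beta> d (e i)"
      using bD by (auto simp: homog_iff_supported e_def D_def intro!: supported_monom)
  next
    fix f :: "'a poly2" assume "homog \<alpha> \<beta> d f"
    then obtain q where q: "q \<in> supported (- S)" "homog \<alpha> \<beta> d q" "f - q \<in> I"
      using span by blast
    have "q = (\<Sum>s\<in>Poly_Mapping.keys q. const (Poly_Mapping.lookup q s) * monom s)"
      by (rule poly_eq_sum_monom)
    also have "\<dots> = (\<Sum>s\<in>D. const (Poly_Mapping.lookup q s) * monom s)"
      using q \<open>finite D\<close> by (intro sum.mono_neutral_left)
        (auto simp: supported_def homog_def D_def in_keys_iff)
    also have "\<dots> = (\<Sum>i<card D. const (Poly_Mapping.lookup q (b i)) * e i)"
      unfolding e_def using b by (rule sum.reindex_bij_betw[symmetric])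
    finally have "f - (\<Sum>i<card D. const (Poly_Mapping.lookup q (b i)) * e i) \<in> I" 
      using q by simp
    hence "const (1 ^ 0) * f - (\<Sum>i<card D. const (Poly_Mapping.lookup q (b i)) * e i) \<in> I" by simp
    thus "\<exists>k c. const (1 ^ k) * f - (\<Sum>i<card D. const (c i) * e i) \<in> I"
      by (intro exI)
  next
    fix c assume "(\<Sum>i<card D. const (c i) * e i) \<in> I"
    moreover have "(\<Sum>i<card D. const (c i) * e i) \<in> supported (- S)"
      using bD unfolding e_def
      by (intro lin.subspace_sum lin.subspace_scale supported_subspace supported_monom) (auto simp: D_def)
    ultimately have 0: "(\<Sum>i<card D. const (c i) * e i) = 0" using indep by blast
    have "c k = 0" if k: "k < card D" for k
    proof -
      have "0 = (\<Sum>i<card D. c i * of_bool (b k = b i))"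
        using arg_cong[OF 0, of "\<lambda>f. Poly_Mapping.lookup f (b k)"]
        by (simp add: lookup_sum e_def lookup_monom)
      also have "\<dots> = (\<Sum>i<card D. if i = k then c i else 0)"
        using inj k by (intro sum.cong) (auto simp: inj_on_def)
      also have "\<dots> = c k" using k by simp
      finally show ?thesis by simp
    qed
    thus "\<exists>k. \<forall>i<card D. 1 ^ k * c i = 0" by simp
  qed
  thus ?thesis unfolding D_def by blast
qed

text \<open>
  The given basis and the standard monomials are two bases of the same vector space.
\<close>

lemma monomial_ideal_hilbert_function:
  fixes M :: "'k::field poly2 set"
  assumes "0 < \<alpha>" "0 < \<beta>" "monomial_ideal M" "has_hilbert_function \<alpha> \<beta> M H"
  shows "H d = card {s. s \<notin> Mons M \<and> mdeg \<alpha> \<beta> s = d}"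
proof -
  note M = monomial_ideal_eq_supported[OF assms(3)]
  obtain e where e: "quot_basis \<alpha> \<beta> 1 M d (H d) e"
    using assms(4) by (auto simp: has_hilbert_function_def)
  obtain e' where e': "quot_basis \<alpha> \<beta> 1 M d (card {s. s \<notin> Mons M \<and> mdeg \<alpha> \<beta> s = d}) e'"
  proof -
    have "\<exists>q. q \<in> supported (- Mons M) \<and> homog \<alpha> \<beta> d q \<and> f - q \<in> M"
      if "homog \<alpha> \<beta> d f" for f :: "'k poly2"
    proof (intro exI conjI)
      define q where "q = (\<Sum>m\<in>Poly_Mapping.keys f - Mons M. const (Poly_Mapping.lookup f m) * monom m)"
      show "q \<in> supported (- Mons M)" unfolding q_def
        by (intro lin.subspace_sum lin.subspace_scale supported_subspace supported_monom) auto
      show "homog \<alpha> \<beta> d q" unfolding q_def homog_iff_supported using that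
        by (intro lin.subspace_sum lin.subspace_scale supported_subspace supported_monom) 
           (auto simp: homog_def)
      have "Poly_Mapping.lookup (f - q) m = 0" if "m \<notin> Mons M" for m
        using that by (auto simp: q_def lookup_minus lookup_sum lookup_monom of_bool_def if_distrib 
           in_keys_iff sum.delta cong: if_cong)
      hence "f - q \<in> supported (Mons M)" by (auto simp: supported_iff)
      thus "f - q \<in> M" using M(2) by simp
    qed
    moreover have "q = 0" if "q \<in> M" "q \<in> supported (- Mons M)" for q
    proof (rule poly_mapping_eqI)
      have "q \<in> supported (Mons M)" using that(1) M(2) by simp
      thus "Poly_Mapping.lookup q m = Poly_Mapping.lookup 0 m" for m
        using that(2) unfolding supported_iff lookup_zero by blast
    qed
    ultimately show ?thesis
      using standard_monomials_quot_basis[OF assms(1,2), of d "Mons M" M] that by blast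
  qed
  show ?thesis using quot_basis_card_unique[OF e e' M(1)] .
qed

section \<open>Monomial ideals in coordinates adapted to the order\<close>

text \<open>
  One development serves both orders.  Here u is the exponent of the larger variable and v that of
  the smaller one, \<open>mk\<close> builds a monomial from the two, and multiplication by \<open>\<rho>\<close> adds B to v and
  subtracts A from u.  Every step of a path therefore decreases u, which is why iterated reduction
  terminates.
\<close>

locale lex_cell =
  fixes lt :: "mon \<Rightarrow> mon \<Rightarrow> bool" and \<rho> :: "int \<times> int"
    and v u :: "mon \<Rightarrow> nat" and mk :: "nat \<Rightarrow> nat \<Rightarrow> mon"
    and A B \<alpha> \<beta> :: nat and S :: "mon set"
  assumes v_mk [simp]: "v (mk a b) = a" and u_mk [simp]: "u (mk a b) = b"
    and mk_v_u [simp]: "mk (v m) (u m) = m"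
    and v_add [simp]: "v (m + m') = v m + v m'" and u_add [simp]: "u (m + m') = u m + u m'"
    and mdvd_iff: "mdvd m m' \<longleftrightarrow> v m \<le> v m' \<and> u m \<le> u m'"
    and v_mlcm [simp]: "v (mlcm m m') = max (v m) (v m')"
    and u_mlcm [simp]: "u (mlcm m m') = max (u m) (u m')"
    and lt_iff: "lt m m' \<longleftrightarrow> u m < u m' \<or> u m = u m' \<and> v m < v m'"
    and rmul_eq: "rmul \<rho> l m =
      (if A * l \<le> u m then Some (mk (v m + B * l) (u m - A * l)) else None)"
    and mdeg_eq: "mdeg \<alpha> \<beta> m = A * v m + B * u m"
    and A_pos: "0 < A" and B_pos: "0 < B"
    and S_closed: "m \<in> S \<Longrightarrow> d + m \<in> S"
begin

lemma mon_eqI: "v m = v m' \<Longrightarrow> u m = u m' \<Longrightarrow> m = m'"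
  by (metis mk_v_u)

lemma mdvd_obtain:
  assumes "mdvd m m'"
  obtains d where "m' = d + m"
proof
  show "m' = mk (v m' - v m) (u m' - u m) + m"
    by (rule mon_eqI) (use assms in \<open>auto simp: mdvd_iff\<close>)
qed

lemma lt_max_exists:
  assumes "finite F" "F \<noteq> {}"
  shows "\<exists>m\<in>F. \<forall>k\<in>F. k = m \<or> lt k m"
  using assms
proof (induction rule: finite_ne_induct)
  case (insert x F)
  then obtain m where m: "m \<in> F" "\<forall>k\<in>F. k = m \<or> lt k m" by blast
  show ?case
  proof (cases "lt m x")
    case True
    hence "\<forall>k\<in>insert x F. k = x \<or> lt k x" using m by (auto simp: lt_iff)
    thus ?thesis by blast
  next
    case False
    hence "x = m \<or> lt x m" using mon_eqI[of x m] unfolding lt_iff by linarith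
    thus ?thesis using m by blast
  qed
qed auto

lemma lead_mon_eqI:
  assumes "m \<in> Poly_Mapping.keys f" "\<And>k. k \<in> Poly_Mapping.keys f \<Longrightarrow> k = m \<or> lt k m"
  shows "lead_mon lt f = m"
  unfolding lead_mon_def
proof (rule the_equality)
  fix m' assume "m' \<in> Poly_Mapping.keys f \<and> (\<forall>k\<in>Poly_Mapping.keys f. k = m' \<or> lt k m')"
  thus "m' = m" using assms by (metis lt_iff order_less_asym less_irrefl)
qed (use assms in auto)

text \<open>The exponent vector of \<open>m \<rho>^l\<close>, which is meaningful when \<open>A * l \<le> u m\<close>.\<close>

definition rm :: "nat \<Rightarrow> mon \<Rightarrow> mon"
  where "rm l m = mk (v m + B * l) (u m - A * l)"

lemma v_rm [simp]: "v (rm l m) = v m + B * l"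
  and u_rm [simp]: "u (rm l m) = u m - A * l"
  by (simp_all add: rm_def)

lemma rm_0 [simp]: "rm 0 m = m"
  by (simp add: rm_def)

lemma rm_add: "rm (k + l) m = rm l (rm k m)"
  by (rule mon_eqI) (simp_all add: algebra_simps)

lemma rm_plus: "A * l \<le> u m \<Longrightarrow> rm l (d + m) = d + rm l m"
  by (rule mon_eqI) simp_all

lemma rmul_Some: "A * l \<le> u m \<Longrightarrow> rmul \<rho> l m = Some (rm l m)"
  by (simp add: rmul_eq rm_def)

lemma rmul_Some_iff: "rmul \<rho> l m = Some m' \<longleftrightarrow> A * l \<le> u m \<and> m' = rm l m"
  by (auto simp: rmul_eq rm_def)

lemma mdeg_rm: "A * l \<le> u m \<Longrightarrow> mdeg \<alpha> \<beta> (rm l m) = mdeg \<alpha> \<beta> m"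
proof -
  assume "A * l \<le> u m"
  then obtain t where "u m = A * l + t" using le_Suc_ex by blast
  thus ?thesis by (simp add: mdeg_eq algebra_simps)
qed

section \<open>The minimal generators and the index j(m)\<close>

abbreviation e :: nat where "e \<equiv> length (gens lt S)"
abbreviation gen :: "nat \<Rightarrow> mon" where "gen i \<equiv> gens lt S ! i"

lemma min_gens_antichain:
  assumes "m \<in> min_gens S" "m' \<in> min_gens S" "v m \<le> v m'" "u m \<le> u m'"
  shows "m = m'"
  using assms by (auto simp: min_gens_def mdvd_iff)

lemma min_gens_inj: "inj_on u (min_gens S)" "inj_on v (min_gens S)"
  by (rule inj_onI; metis min_gens_antichain nle_le order_refl)+

text \<open>
  An antichain in the plane is finite: every other element has one coordinate below that of a chosen
  element, and each coordinate is injective on the antichain.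
\<close>

lemma finite_min_gens: "finite (min_gens S)"
proof (cases "min_gens S = {}")
  case False
  then obtain p where p: "p \<in> min_gens S" by blast
  have "finite {m \<in> min_gens S. v m \<le> v p}"
    by (rule inj_on_finite[of v _ "{..v p}"]) (auto intro: inj_on_subset[OF min_gens_inj(2)])
  moreover have "finite {m \<in> min_gens S. u m \<le> u p}"
    by (rule inj_on_finite[of u _ "{..u p}"]) (auto intro: inj_on_subset[OF min_gens_inj(1)])
  moreover have "min_gens S \<subseteq> {m \<in> min_gens S. v m \<le> v p} \<union> {m \<in> min_gens S. u m \<le> u p}"
  proof
    fix m assume m: "m \<in> min_gens S"
    have "v m \<le> v p \<or> u m \<le> u p"
      using min_gens_antichain[OF p m] by (metis nat_le_linear)
    thus "m \<in> {m \<in> min_gens S. v m \<le> v p} \<union> {m \<in> min_gens S. u m \<le> u p}" using m by blast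
  qed
  ultimately show ?thesis using finite_subset by blast
qed simp

lemma gens_props: "set (gens lt S) = min_gens S" "sorted_wrt lt (gens lt S)"
proof -
  let ?G = "min_gens S"
  have sorted_u: "sorted_wrt (<) (map u ms)" if "set ms = ?G" "sorted_wrt lt ms" for ms
    unfolding sorted_wrt_map
  proof (rule sorted_wrt_mono_rel[OF _ that(2)])
    fix m m' assume "m \<in> set ms" "m' \<in> set ms" "lt m m'"
    thus "u m < u m'"
      using inj_onD[OF min_gens_inj(1), of m m'] that(1) by (auto simp: lt_iff)
  qed
  define ms where "ms = map (the_inv_into ?G u) (sorted_list_of_set (u ` ?G))"
  have inv: "u (the_inv_into ?G u b) = b" if "b \<in> u ` ?G" for b
    using that min_gens_inj(1) by (rule f_the_inv_into_f[rotated])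
  have "set ms = the_inv_into ?G u ` u ` ?G"
    using finite_min_gens by (simp add: ms_def)
  hence "set ms = ?G"
    using min_gens_inj(1) by (auto simp: the_inv_into_f_f image_image)
  moreover have "sorted_wrt lt ms"
    unfolding ms_def sorted_wrt_map
  proof (rule sorted_wrt_mono_rel[OF _ strict_sorted_list_of_set])
    fix a b assume "a \<in> set (sorted_list_of_set (u ` ?G))" "b \<in> set (sorted_list_of_set (u ` ?G))" "a < b"
    thus "lt (the_inv_into ?G u a) (the_inv_into ?G u b)"
      using finite_min_gens by (simp add: lt_iff inv)
  qed
  ultimately have ms: "set ms = ?G \<and> sorted_wrt lt ms" by blast
  have "set (gens lt S) = ?G \<and> sorted_wrt lt (gens lt S)"
    unfolding gens_def
  proof (rule theI[where a = ms], rule ms)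
    fix xs assume xs: "set xs = ?G \<and> sorted_wrt lt xs"
    have "map u xs = map u ms"
      using sorted_u xs ms by (intro strict_sorted_equal) auto
    thus "xs = ms"
      by (rule map_inj_on) (use xs ms min_gens_inj(1) in simp)
  qed
  thus "set (gens lt S) = min_gens S" "sorted_wrt lt (gens lt S)" by auto
qed

lemma gen_min: "i < e \<Longrightarrow> gen i \<in> min_gens S"
  using gens_props(1) by (metis nth_mem)

lemma gen_in: "i < e \<Longrightarrow> gen i \<in> S"
  using gen_min by (auto simp: min_gens_def)

lemma u_gen_less: "i < j \<Longrightarrow> j < e \<Longrightarrow> u (gen i) < u (gen j)"
proof -
  assume ij: "i < j" "j < e"
  hence "lt (gen i) (gen j)" using gens_props(2) sorted_wrt_nth_less by blast
  moreover have "u (gen i) = u (gen j) \<Longrightarrow> v (gen i) < v (gen j) \<Longrightarrow> False"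
    using min_gens_antichain[OF gen_min gen_min, of i j] ij by auto
  ultimately show ?thesis by (auto simp: lt_iff)
qed

lemma u_gen_mono: "i \<le> j \<Longrightarrow> j < e \<Longrightarrow> u (gen i) \<le> u (gen j)"
  using u_gen_less[of i j] by (cases "i = j") auto

lemma v_gen_antimono: "i \<le> j \<Longrightarrow> j < e \<Longrightarrow> v (gen j) \<le> v (gen i)"
  using min_gens_antichain[OF gen_min gen_min, of i j] u_gen_mono[of i j] by force

lemma gen_inj: "i < e \<Longrightarrow> j < e \<Longrightarrow> gen i = gen j \<Longrightarrow> i = j"
  by (metis u_gen_less less_irrefl linorder_neqE_nat)

lemma gen_dividing_exists:
  assumes "m \<in> S"
  shows "\<exists>i<e. mdvd (gen i) m"
  using assms
proof (induction "v m + u m" arbitrary: m rule: less_induct)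
  case less
  show ?case
  proof (cases "m \<in> min_gens S")
    case True
    thus ?thesis using gens_props(1) by (metis in_set_conv_nth mdvd_iff order_refl)
  next
    case False
    then obtain m' where m': "m' \<in> S" "mdvd m' m" "m' \<noteq> m"
      using less.prems by (auto simp: min_gens_def)
    hence "v m' + u m' < v m + u m" using mon_eqI[of m' m] unfolding mdvd_iff by linarith
    then obtain i where "i < e" "mdvd (gen i) m'" using less.hyps m' by blast
    thus ?thesis using m'(2) by (auto simp: mdvd_iff intro: order_trans)
  qed
qed

text \<open>
  Along the generators u increases and v decreases, so the indices of the generators that divide m
  form an interval, whose right end is determined by u alone.  This is what makes the choice of
  \<open>j(m)\<close> compatible with multiplication by the smaller variable.
\<close>

lemma jmax_props:
  assumes "m \<in> S"
  shows jmax_less: "jmax lt S m < e" and jmax_mdvd: "mdvd (gen (jmax lt S m)) m"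
    and jmax_ge: "\<And>j. j < e \<Longrightarrow> u (gen j) \<le> u m \<Longrightarrow> j \<le> jmax lt S m"
proof -
  let ?D = "{j. j < e \<and> mdvd (gen j) m}"
  have D: "finite ?D" "?D \<noteq> {}" using gen_dividing_exists[OF assms] by auto
  hence "jmax lt S m \<in> ?D" unfolding jmax_def by (rule Max_in)
  thus jm: "jmax lt S m < e" "mdvd (gen (jmax lt S m)) m" by auto
  fix j assume j: "j < e" "u (gen j) \<le> u m"
  show "j \<le> jmax lt S m"
  proof (rule ccontr)
    assume nle: "\<not> j \<le> jmax lt S m"
    hence "v (gen j) \<le> v m"
      using v_gen_antimono[of "jmax lt S m" j] j jm by (auto simp: mdvd_iff)
    hence "j \<in> ?D" using j by (simp add: mdvd_iff)
    hence "j \<le> jmax lt S m" unfolding jmax_def using D by (intro Max_ge)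
    thus False using nle by simp
  qed
qed

lemma u_gen_jmax: "m \<in> S \<Longrightarrow> u (gen (jmax lt S m)) \<le> u m"
  using jmax_mdvd by (simp add: mdvd_iff)

lemma jmax_cong:
  assumes "m \<in> S" "m' \<in> S" "u m = u m'"
  shows "jmax lt S m = jmax lt S m'"
proof (rule antisym)
  show "jmax lt S m \<le> jmax lt S m'"
    using assms jmax_less u_gen_jmax[of m] by (intro jmax_ge) auto
  show "jmax lt S m' \<le> jmax lt S m"
    using assms jmax_less u_gen_jmax[of m'] by (intro jmax_ge) auto
qed

lemma jmax_eqI:
  assumes "m \<in> S" "i < e" "u (gen i) \<le> u m" "\<And>j. j < e \<Longrightarrow> u (gen j) \<le> u m \<Longrightarrow> j \<le> i"
  shows "jmax lt S m = i"
  using assms jmax_less[of m] u_gen_jmax[of m] jmax_ge[of m i] by (intro antisym) auto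

lemma jmax_gen: "i < e \<Longrightarrow> jmax lt S (gen i) = i"
  using u_gen_less by (intro jmax_eqI gen_in) (auto simp flip: not_less)

section \<open>Significant arrows and paths\<close>

text \<open>
  The arrow \<open>c_i^l\<close> contributes a multiple of \<open>f_j\<close> to \<open>f_i\<close>, where \<open>j = tgt i l\<close>, and a path
  that starts with this arrow goes on from \<open>m_j\<close>.
\<close>

definition arr :: "nat \<Rightarrow> nat set"
  where "arr i = {l. (gen i, l) \<in> sig_arrows lt \<rho> S}"

definition tgt :: "nat \<Rightarrow> nat \<Rightarrow> nat"
  where "tgt i l = jmax lt S (rm l (wlcm lt S i))"

lemma wlcm_coords:
  assumes "1 \<le> i" "i < e"
  shows "u (wlcm lt S i) = u (gen i)" "v (wlcm lt S i) = v (gen (i - 1))"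
  using assms u_gen_mono[of "i - 1" i] v_gen_antimono[of "i - 1" i] by (auto simp: wlcm_def)

lemma arr_iff:
  assumes "1 \<le> i" "i < e"
  shows "l \<in> arr i \<longleftrightarrow> 0 < l \<and> A * l \<le> u (gen i) \<and> rm l (gen i) \<notin> S \<and> rm l (wlcm lt S i) \<in> S"
  using assms gen_inj wlcm_coords[OF assms]
  by (auto simp: arr_def sig_arrows_def rmul_Some_iff)

lemma arr_props:
  assumes "1 \<le> i" "i < e" "l \<in> arr i"
  shows "0 < l" "A * l \<le> u (gen i)" "rm l (wlcm lt S i) \<in> S" "tgt i l < i" "tgt i l < e"
    "A * l + u (gen (tgt i l)) \<le> u (gen i)"
proof -
  show l: "0 < l" "A * l \<le> u (gen i)" "rm l (wlcm lt S i) \<in> S"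
    using assms arr_iff by auto
  show t: "tgt i l < e" unfolding tgt_def by (rule jmax_less[OF l(3)])
  show le: "A * l + u (gen (tgt i l)) \<le> u (gen i)"
    using u_gen_jmax[OF l(3)] l(2) wlcm_coords[OF assms(1,2)] by (simp add: tgt_def)
  have "0 < A * l" using l A_pos by simp
  hence "u (gen (tgt i l)) < u (gen i)" using le by linarith
  thus "tgt i l < i" using u_gen_mono[of i "tgt i l"] t by (metis not_less)
qed

lemma finite_arr: "1 \<le> i \<Longrightarrow> i < e \<Longrightarrow> finite (arr i)"
proof (rule finite_subset)
  assume i: "1 \<le> i" "i < e"
  show "arr i \<subseteq> {..u (gen i)}"
  proof
    fix l assume "l \<in> arr i"
    hence "A * l \<le> u (gen i)" using arr_props i by blast
    moreover have "l \<le> A * l" using A_pos by (cases A) auto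
    ultimately show "l \<in> {..u (gen i)}" unfolding atMost_iff by linarith
  qed
qed simp

definition paths :: "nat \<Rightarrow> path set"
  where "paths i = {P. is_path lt \<rho> S i P}"

definition paths0 :: "nat \<Rightarrow> path set"
  where "paths0 i = insert [] (paths i)"

lemma is_path_head: "is_path lt \<rho> S i P \<Longrightarrow> \<exists>k l P'. k \<le> i \<and> k < e \<and> P = (gen k, l) # P'"
proof (induction rule: is_path.induct)
  case (down i P)
  then obtain k l P' where "k \<le> i - 1" "k < e" "P = (gen k, l) # P'" by blast
  moreover have "k \<le> i" using \<open>k \<le> i - 1\<close> by simp
  ultimately show ?case by blast
qed blast+

lemma path_arrows: "is_path lt \<rho> S i P \<Longrightarrow> set P \<subseteq> sig_arrows lt \<rho> S"
  by (induction rule: is_path.induct) auto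

lemma paths0_0: "paths0 0 = {[]}"
proof -
  have "\<not> is_path lt \<rho> S 0 P" for P
    by (auto elim: is_path.cases)
  thus ?thesis by (auto simp: paths0_def paths_def)
qed

text \<open>
  With the empty path allowed, the three rules for paths become the recursion of the \<open>f_i\<close>: a path
  either avoids the arrows at \<open>m_i\<close>, or starts with one of them and goes on from its target.
\<close>

lemma paths0_rec:
  assumes "1 \<le> i" "i < e"
  shows "paths0 i = paths0 (i - 1) \<union> (\<lambda>(l, P). (gen i, l) # P) ` Sigma (arr i) (\<lambda>l. paths0 (tgt i l))"
    (is "_ = ?R")
proof (intro equalityI subsetI)
  fix P assume "P \<in> paths0 i"
  then consider "P = []" | "is_path lt \<rho> S i P" by (auto simp: paths0_def paths_def)
  thus "P \<in> ?R"
  proof cases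
    case 2
    thus ?thesis
    proof cases
      case (single l)
      thus ?thesis by (intro UnI2 image_eqI[of _ _ "(l, [])"]) (auto simp: arr_def paths0_def)
    next
      case down
      thus ?thesis by (auto simp: paths0_def paths_def)
    next
      case (step l w P')
      thus ?thesis by (intro UnI2 image_eqI[of _ _ "(l, P')"])
        (auto simp: arr_def paths0_def paths_def tgt_def rmul_Some_iff)
    qed
  qed (simp add: paths0_def)
next
  fix P assume "P \<in> ?R"
  then consider "P \<in> paths0 (i - 1)"
    | l P' where "l \<in> arr i" "P' \<in> paths0 (tgt i l)" "P = (gen i, l) # P'" by auto
  thus "P \<in> paths0 i"
  proof cases
    case 1
    thus ?thesis using assms by (auto simp: paths0_def paths_def intro: is_path.down)
  next
    case (2 l P')
    hence l: "(gen i, l) \<in> sig_arrows lt \<rho> S" by (simp add: arr_def)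
    have "is_path lt \<rho> S i P"
    proof (cases "P' = []")
      case True
      thus ?thesis using 2 l assms by (auto intro: is_path.single)
    next
      case False
      have "rmul \<rho> l (wlcm lt S i) = Some (rm l (wlcm lt S i))"
        using arr_props(2)[OF assms 2(1)] wlcm_coords[OF assms] by (simp add: rmul_Some)
      thus ?thesis using 2 l assms False
        by (auto simp: paths0_def paths_def tgt_def intro: is_path.step)
    qed
    thus ?thesis by (simp add: paths0_def paths_def)
  qed
qed

text \<open>
  The two kinds of paths are told apart by their first arrow, since an arrow records the generator
  at which it starts.
\<close>

lemma paths0_disjoint:
  assumes "1 \<le> i" "i < e"
  shows "paths0 (i - 1) \<inter> (\<lambda>(l, P). (gen i, l) # P) ` Sigma (arr i) (\<lambda>l. paths0 (tgt i l)) = {}"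
proof -
  have "(gen i, l) # P \<notin> paths0 (i - 1)" for l P
  proof
    assume "(gen i, l) # P \<in> paths0 (i - 1)"
    then obtain k where "k \<le> i - 1" "k < e" "gen i = gen k"
      using is_path_head[of "i - 1" "(gen i, l) # P"] by (auto simp: paths0_def paths_def)
    thus False using gen_inj[of i k] assms by auto
  qed
  thus ?thesis by auto
qed

lemma paths0_bounds:
  "i < e \<Longrightarrow> finite (paths0 i) \<and> (\<forall>P\<in>paths0 i. A * path_len P \<le> u (gen i) \<and> (P \<noteq> [] \<longrightarrow> 0 < path_len P))"
proof (induction i rule: less_induct)
  case (less i)
  show ?case
  proof (cases "i = 0")
    case True
    thus ?thesis by (simp add: paths0_0 path_len_def)
  next
    case False
    hence i: "1 \<le> i" "i < e" using less.prems by auto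
    have "i - 1 < i" "i - 1 < e" using i by auto
    note IH = less.IH[OF this]
    have "u (gen (i - 1)) \<le> u (gen i)" using i by (intro u_gen_mono) auto
    hence IH1: "finite (paths0 (i - 1))"
      "\<And>P. P \<in> paths0 (i - 1) \<Longrightarrow> A * path_len P \<le> u (gen i) \<and> (P \<noteq> [] \<longrightarrow> 0 < path_len P)"
      using IH order_trans by blast+
    have IH2: "finite (paths0 (tgt i l))"
      "\<And>P. P \<in> paths0 (tgt i l) \<Longrightarrow> A * path_len P \<le> u (gen (tgt i l))" if "l \<in> arr i" for l
      using less.IH[of "tgt i l"] arr_props[OF i that] by auto
    show ?thesis
      unfolding paths0_rec[OF i]
    proof (intro conjI ballI)
      show "finite (paths0 (i - 1) \<union>
          (\<lambda>(l, P). (gen i, l) # P) ` Sigma (arr i) (\<lambda>l. paths0 (tgt i l)))"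
        using IH1 IH2 finite_arr[OF i] by auto
    next
      fix P assume P: "P \<in> paths0 (i - 1) \<union>
          (\<lambda>(l, P). (gen i, l) # P) ` Sigma (arr i) (\<lambda>l. paths0 (tgt i l))"
      have "A * path_len P \<le> u (gen i) \<and> (P \<noteq> [] \<longrightarrow> 0 < path_len P)"
      proof (cases "P \<in> paths0 (i - 1)")
        case False
        then obtain l P' where l: "l \<in> arr i" "P' \<in> paths0 (tgt i l)" "P = (gen i, l) # P'"
          using P by auto
        have "A * path_len P' \<le> u (gen (tgt i l))" using IH2(2)[OF l(1,2)] .
        hence "A * (l + path_len P') \<le> u (gen i)"
          using arr_props(6)[OF i l(1)] by (simp add: algebra_simps)
        thus ?thesis using arr_props(1)[OF i l(1)] l(3) by (simp add: path_len_def)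
      qed (use IH1 in blast)
      thus "A * path_len P \<le> u (gen i)" "P \<noteq> [] \<longrightarrow> 0 < path_len P" by auto
    qed
  qed
qed

lemma finite_paths0: "i < e \<Longrightarrow> finite (paths0 i)"
  and path_len_le: "i < e \<Longrightarrow> P \<in> paths0 i \<Longrightarrow> A * path_len P \<le> u (gen i)"
  and path_len_pos: "i < e \<Longrightarrow> P \<in> paths0 i \<Longrightarrow> P \<noteq> [] \<Longrightarrow> 0 < path_len P"
  using paths0_bounds by auto

lemma path_simps [simp]:
  "path_len [] = 0" "path_coeff X [] = 1"
  "path_len ((m, l) # P) = l + path_len P" "path_coeff X (c # P) = X c * path_coeff X P"
  by (simp_all add: path_len_def path_coeff_def)

section \<open>The family as a sum over paths\<close>

text \<open>
  \<open>pathsum X i m\<close> is \<open>(m / m_i) f_i\<close>, also in the cases where \<open>m / m_i\<close> is only a Laurent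
  monomial.  Writing it as a sum over paths avoids all division.
\<close>

definition pathsum :: "(arrow \<Rightarrow> 'a::comm_ring_1) \<Rightarrow> nat \<Rightarrow> mon \<Rightarrow> 'a poly2"
  where "pathsum X i m = (\<Sum>P\<in>paths0 i. const (path_coeff X P) * monom (rm (path_len P) m))"

lemma pathsum_0: "pathsum X 0 m = monom m"
  by (simp add: pathsum_def paths0_0)

lemma pathsum_rec:
  assumes i: "1 \<le> i" "i < e"
  shows "pathsum X i m = pathsum X (i - 1) m +
    (\<Sum>l\<in>arr i. const (X (gen i, l)) * pathsum X (tgt i l) (rm l m))"
proof -
  let ?t = "\<lambda>P. const (path_coeff X P) * (monom (rm (path_len P) m) :: 'a poly2)"
  let ?C = "Sigma (arr i) (\<lambda>l. paths0 (tgt i l))"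
  have fin: "finite ?C"
    using arr_props(5)[OF i] by (intro finite_SigmaI finite_arr[OF i] finite_paths0)
  have "pathsum X i m = pathsum X (i - 1) m + sum ?t ((\<lambda>(l, P). (gen i, l) # P) ` ?C)"
    unfolding pathsum_def paths0_rec[OF i]
    using i fin finite_paths0 paths0_disjoint[OF i] by (intro sum.union_disjoint) auto
  also have "sum ?t ((\<lambda>(l, P). (gen i, l) # P) ` ?C) =
      (\<Sum>(l, P)\<in>?C. const (X (gen i, l)) * (const (path_coeff X P) * monom (rm (path_len P) (rm l m))))"
    by (subst sum.reindex) (auto simp: inj_on_def const_mult mult.assoc rm_add intro!: sum.cong)
  also have "\<dots> = (\<Sum>l\<in>arr i. const (X (gen i, l)) * pathsum X (tgt i l) (rm l m))"
    using finite_arr[OF i] arr_props[OF i] finite_paths0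
    by (subst sum.Sigma[symmetric]) (auto simp: pathsum_def sum_distrib_left)
  finally show ?thesis .
qed

lemma pathsum_shift:
  assumes "i < e" "u (gen i) \<le> u m"
  shows "pathsum X i (d + m) = monom d * pathsum X i m"
proof -
  have "rm (path_len P) (d + m) = d + rm (path_len P) m" if "P \<in> paths0 i" for P
    using path_len_le[OF assms(1) that] assms(2) by (intro rm_plus) simp
  thus ?thesis
    by (simp add: pathsum_def sum_distrib_left mult.left_commute flip: monom_mult)
qed

lemma mon_frac_pathsum:
  assumes "i < e" "u (gen i) \<le> u m"
  shows "mon_frac m (gen i) (pathsum X i (gen i)) = pathsum X i m"
  using pathsum_shift[OF assms, of X "gen i"] pathsum_shift[of i "gen i" X m] assms
  by (intro mon_frac_eq) (simp add: add.commute)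

lemma fam_eq_pathsum:
  "i < e \<Longrightarrow> fam lt \<rho> S X i = pathsum X i (gen i)"
proof (induction i rule: less_induct)
  case (less i)
  show ?case
  proof (cases i)
    case 0
    thus ?thesis by (simp add: pathsum_0)
  next
    case (Suc k)
    hence i: "1 \<le> i" "i < e" using less.prems by auto
    have 1: "mon_frac (gen i) (gen k) (fam lt \<rho> S X k) = pathsum X (i - 1) (gen i)"
      using less.IH[of k] Suc i u_gen_mono[of k i] by (simp add: mon_frac_pathsum)
    have 2: "(let j = jmax lt S (the (rmul \<rho> l (wlcm lt S i))) in
        if j < i then const (X (gen i, l)) *
          mon_frac (the (rmul \<rho> l (gen i))) (gen j) (fam lt \<rho> S X j) else 0) =
        const (X (gen i, l)) * pathsum X (tgt i l) (rm l (gen i))" if "l \<in> arr i" for l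
    proof -
      note l = arr_props[OF i that]
      have "the (rmul \<rho> l (wlcm lt S i)) = rm l (wlcm lt S i)" "the (rmul \<rho> l (gen i)) = rm l (gen i)"
        using l(2) wlcm_coords[OF i] by (simp_all add: rmul_Some)
      moreover have "mon_frac (rm l (gen i)) (gen (tgt i l)) (fam lt \<rho> S X (tgt i l)) =
          pathsum X (tgt i l) (rm l (gen i))"
        using less.IH l by (simp add: mon_frac_pathsum)
      ultimately show ?thesis using l(4) by (simp add: Let_def flip: tgt_def)
    qed
    have "fam lt \<rho> S X i = pathsum X (i - 1) (gen i) +
        (\<Sum>l\<in>arr i. const (X (gen i, l)) * pathsum X (tgt i l) (rm l (gen i)))"
      using 1 2 unfolding Suc by (simp add: arr_def)
    also have "\<dots> = pathsum X i (gen i)" by (rule pathsum_rec[OF i, symmetric])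
    finally show ?thesis .
  qed
qed

section \<open>The Groebner basis property\<close>

definition fam_ideal :: "(arrow \<Rightarrow> 'a::comm_ring_1) \<Rightarrow> 'a poly2 set"
  where "fam_ideal X = ideal_gen (fam lt \<rho> S X ` {..<e})"

lemma is_ideal_fam_ideal: "is_ideal (fam_ideal X)"
  unfolding fam_ideal_def by (rule idl.subspace_span)

text \<open>\<open>rep X m\<close> is \<open>(m / m_j) f_j\<close> for \<open>j = j(m)\<close>.\<close>

definition rep :: "(arrow \<Rightarrow> 'a::comm_ring_1) \<Rightarrow> mon \<Rightarrow> 'a poly2"
  where "rep X m = pathsum X (jmax lt S m) m"

text \<open>
  As \<open>j(m)\<close> depends on u only, multiplication by the smaller variable satisfies the hypothesis.
\<close>

lemma rep_shift:
  assumes "m \<in> S" "jmax lt S (d + m) = jmax lt S m"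
  shows "rep X (d + m) = monom d * rep X m"
  using assms by (simp add: rep_def pathsum_shift jmax_less u_gen_jmax)

lemma rep_gen: "i < e \<Longrightarrow> rep X (gen i) = fam lt \<rho> S X i"
  by (simp add: rep_def jmax_gen fam_eq_pathsum)

lemma rep_in_fam_ideal:
  assumes "m \<in> S"
  shows "rep X m \<in> fam_ideal X"
proof -
  obtain d where d: "m = d + gen (jmax lt S m)"
    using jmax_mdvd[OF assms] by (rule mdvd_obtain)
  let ?j = "jmax lt S m"
  have "rep X m = monom d * fam lt \<rho> S X ?j"
    unfolding rep_def
    by (subst d, subst pathsum_shift) (simp_all add: assms jmax_less fam_eq_pathsum)
  moreover have "fam lt \<rho> S X ?j \<in> fam_ideal X"
    unfolding fam_ideal_def using jmax_less[OF assms] by (intro idl.span_base imageI) simp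
  ultimately show ?thesis
    by (simp add: idl.subspace_scale[OF is_ideal_fam_ideal])
qed

abbreviation rep_span :: "(arrow \<Rightarrow> 'a::comm_ring_1) \<Rightarrow> 'a poly2 set"
  where "rep_span X \<equiv> lin.span (rep X ` S)"

lemma minor_var_rep:
  assumes "m \<in> S"
  shows "monom (mk 1 0) * rep X m \<in> rep_span X"
proof -
  have "rep X (mk 1 0 + m) = monom (mk 1 0) * rep X m"
    by (intro rep_shift assms jmax_cong S_closed) simp
  moreover have "rep X (mk 1 0 + m) \<in> rep_span X"
    by (intro lin.span_base imageI S_closed assms)
  ultimately show ?thesis by simp
qed

text \<open>
  If multiplication by the larger variable leaves \<open>j(m)\<close> unchanged, there is nothing to do.
  Otherwise \<open>j(m)\<close> moves to the next index i, and the monomial reached is a multiple of \<open>w_i\<close> by a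
  power of the smaller variable.  The recursion for \<open>f_i\<close> then writes the product by elements of the
  same shape: the arrows at \<open>m_i\<close> lead from \<open>w_i\<close> to monomials of S, and their targets are the
  indices j of these monomials.
\<close>

lemma major_var_rep:
  assumes m: "m \<in> S"
  shows "monom (mk 0 1) * rep X m \<in> rep_span X"
proof -
  define d where "d = mk 0 1"
  let ?j = "jmax lt S m"
  let ?i = "jmax lt S (d + m)"
  have m': "d + m \<in> S" using m by (rule S_closed)
  have u': "u (d + m) = Suc (u m)" by (simp add: d_def)
  have j: "?j < e" "u (gen ?j) \<le> u m" using m jmax_less u_gen_jmax by auto
  have i: "?i < e" "u (gen ?i) \<le> Suc (u m)" using jmax_less[OF m'] u_gen_jmax[OF m'] u' by auto
  have base: "k \<in> S \<Longrightarrow> rep X k \<in> rep_span X" for k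
    by (intro lin.span_base imageI)
  show ?thesis
  proof (cases "?i = ?j")
    case True
    hence "rep X (d + m) = monom d * rep X m" by (intro rep_shift m)
    thus ?thesis using base[OF m'] by (simp add: d_def)
  next
    case False
    have "?j \<le> ?i" using j u' by (intro jmax_ge[OF m']) auto
    hence ji: "?j < ?i" using False by simp
    have "\<not> u (gen ?i) \<le> u m" using jmax_ge[OF m i(1)] ji by auto
    hence ui: "u (gen ?i) = u (d + m)" using i(2) u' by simp
    have "\<not> Suc ?j < ?i"
    proof
      assume *: "Suc ?j < ?i"
      hence "u (gen (Suc ?j)) \<le> u m" using u_gen_less[OF * i(1)] ui u' by simp
      hence "Suc ?j \<le> ?j" using * i(1) by (intro jmax_ge[OF m]) auto
      thus False by simp
    qed
    hence i_eq: "?i - 1 = ?j" and i1: "1 \<le> ?i" using ji by auto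
    have v_le: "v (gen ?j) \<le> v m" using jmax_mdvd[OF m] by (simp add: mdvd_iff)
    have arrow: "rm l (d + m) \<in> S \<and> pathsum X (tgt ?i l) (rm l (d + m)) = rep X (rm l (d + m))"
      if "l \<in> arr ?i" for l
    proof -
      note l = arr_props[OF i1 i(1) that]
      note w = wlcm_coords[OF i1 i(1)]
      have "d + m = mk (v m - v (gen ?j)) 0 + wlcm lt S ?i"
        by (rule mon_eqI) (use w v_le ui i_eq in \<open>simp_all add: d_def\<close>)
      hence "rm l (d + m) = rm l (mk (v m - v (gen ?j)) 0 + wlcm lt S ?i)"
        by (rule arg_cong)
      also have "\<dots> = mk (v m - v (gen ?j)) 0 + rm l (wlcm lt S ?i)"
        using l(2) w by (intro rm_plus) simp
      finally have eq: "rm l (d + m) = mk (v m - v (gen ?j)) 0 + rm l (wlcm lt S ?i)" .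
      hence in_S: "rm l (d + m) \<in> S" using S_closed[OF l(3)] by simp
      have "jmax lt S (rm l (d + m)) = tgt ?i l"
        unfolding tgt_def by (rule jmax_cong[OF in_S l(3)]) (simp add: eq)
      thus ?thesis using in_S by (simp add: rep_def)
    qed
    have "rep X (d + m) = monom d * rep X m +
        (\<Sum>l\<in>arr ?i. const (X (gen ?i, l)) * pathsum X (tgt ?i l) (rm l (d + m)))"
      unfolding rep_def[of X "d + m"] pathsum_rec[OF i1 i(1)] i_eq
      using j by (simp add: rep_def pathsum_shift)
    hence "monom d * rep X m = rep X (d + m) -
        (\<Sum>l\<in>arr ?i. const (X (gen ?i, l)) * rep X (rm l (d + m)))"
      using arrow by simp
    also have "\<dots> \<in> rep_span X"
      using arrow base m' by (intro lin.span_diff lin.span_sum lin.span_scale) auto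
    finally show ?thesis by (simp add: d_def)
  qed
qed

lemma is_ideal_rep_span: "is_ideal (rep_span X)"
proof (rule ideal_monom_mult_closedI[OF lin.subspace_span])
  have step: "monom d * f \<in> rep_span X"
    if "\<And>m. m \<in> S \<Longrightarrow> monom d * rep X m \<in> rep_span X" "f \<in> rep_span X" for d f
    using that(2)
  proof (induction rule: lin.span_induct_alt)
    case base thus ?case by (simp add: lin.span_zero)
  next
    case (step c x y)
    have "monom d * (const c * x + y) = const c * (monom d * x) + monom d * y"
      by (simp add: algebra_simps)
    thus ?case using step that(1) by (auto intro!: lin.span_add lin.span_scale)
  qed
  fix f m assume f: "f \<in> rep_span X"
  have v0: "v 0 = 0" "u 0 = 0" using v_add[of 0 0] u_add[of 0 0] by simp_all
  have "monom (mk 0 b) * f \<in> rep_span X" for b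
  proof (induction b)
    case 0
    have "mk 0 0 = 0" by (rule mon_eqI) (simp_all add: v0)
    thus ?case using f by (simp add: monom_def)
  next
    case (Suc b)
    have "mk 0 (Suc b) = mk 0 1 + mk 0 b" by (rule mon_eqI) simp_all
    thus ?case using step[OF major_var_rep Suc.IH] by (simp add: mult.assoc flip: monom_mult)
  qed
  hence "monom (mk a b) * f \<in> rep_span X" for a b
  proof (induction a)
    case (Suc a)
    have "mk (Suc a) b = mk 1 0 + mk a b" by (rule mon_eqI) simp_all
    thus ?case using step[OF minor_var_rep Suc.IH[OF Suc.prems]]
      by (simp add: mult.assoc flip: monom_mult)
  qed
  from this[of "v m" "u m"] show "monom m * f \<in> rep_span X" by simp
qed

lemma fam_ideal_eq_rep_span: "fam_ideal X = rep_span X"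
proof
  show "fam_ideal X \<subseteq> rep_span X"
    unfolding fam_ideal_def
  proof (intro idl.span_minimal is_ideal_rep_span subsetI)
    fix f assume "f \<in> fam lt \<rho> S X ` {..<e}"
    then obtain i where "i < e" "f = rep X (gen i)" by (auto simp: rep_gen)
    thus "f \<in> rep_span X" by (auto intro!: lin.span_base imageI gen_in)
  qed
  show "rep_span X \<subseteq> fam_ideal X"
    using rep_in_fam_ideal by (intro lin.span_minimal subspace_if_ideal is_ideal_fam_ideal) auto
qed

lemma pathsum_tail:
  assumes "i < e" "u (gen i) \<le> u m"
  shows "pathsum X i m - monom m \<in> supported {k. u k < u m}"
proof -
  have "pathsum X i m - monom m =
      (\<Sum>P\<in>paths0 i - {[]}. const (path_coeff X P) * monom (rm (path_len P) m))"
    unfolding pathsum_def using finite_paths0[OF assms(1)]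
    by (subst sum.remove[of _ "[]"]) (simp_all add: paths0_def)
  also have "\<dots> \<in> supported {k. u k < u m}"
  proof (intro lin.subspace_sum lin.subspace_scale supported_subspace supported_monom CollectI)
    fix P assume P: "P \<in> paths0 i - {[]}"
    hence "0 < A * path_len P" "A * path_len P \<le> u (gen i)"
      using path_len_pos[OF assms(1)] path_len_le[OF assms(1)] A_pos by auto
    thus "u (rm (path_len P) m) < u m" using assms(2) unfolding u_rm by linarith
  qed
  finally show ?thesis .
qed

lemma rep_lookup:
  assumes "m \<in> S"
  shows "Poly_Mapping.lookup (rep X m) m = 1"
    and "Poly_Mapping.lookup (rep X m) k \<noteq> 0 \<Longrightarrow> k = m \<or> lt k m"
proof -
  have *: "\<not> u k < u m \<Longrightarrow> Poly_Mapping.lookup (rep X m) k = of_bool (k = m)" for k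
    using pathsum_tail[OF jmax_less[OF assms] u_gen_jmax[OF assms], of X]
    unfolding rep_def supported_iff lookup_minus lookup_monom mem_Collect_eq
    by (metis eq_iff_diff_eq_0)
  show "Poly_Mapping.lookup (rep X m) m = 1" using * by simp
  show "Poly_Mapping.lookup (rep X m) k \<noteq> 0 \<Longrightarrow> k = m \<or> lt k m" 
    using *[of k] by (auto simp: lt_iff)
qed

text \<open>
  The elements \<open>rep X m\<close> are monic with leading monomial m, and these leading monomials are
  distinct, so the largest one that occurs in a combination cannot cancel.
\<close>

lemma fam_ideal_lead:
  assumes "f \<in> fam_ideal X" "f \<noteq> 0"
  obtains m where "m \<in> S" "m \<in> Poly_Mapping.keys f"
    "\<And>k. k \<in> Poly_Mapping.keys f \<Longrightarrow> k = m \<or> lt k m"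
proof -
  obtain t r where t: "finite t" "t \<subseteq> rep X ` S" "f = (\<Sum>a\<in>t. const (r a) * a)"
    using assms(1) unfolding fam_ideal_eq_rep_span lin.span_explicit by auto
  obtain F where F: "F \<subseteq> S" "inj_on (rep X) F" "t = rep X ` F"
    using t(2) unfolding subset_image_inj by auto
  have "finite F" using finite_imageD F t(1) by auto
  define c where "c m = r (rep X m)" for m
  define F' where "F' = {m \<in> F. c m \<noteq> 0}"
  have "finite F'" using \<open>finite F\<close> by (simp add: F'_def)
  have "f = (\<Sum>m\<in>F. const (c m) * rep X m)"
    unfolding t(3) F(3) by (simp add: sum.reindex[OF F(2)] c_def)
  also have "\<dots> = (\<Sum>m\<in>F'. const (c m) * rep X m)"
    using \<open>finite F\<close> by (intro sum.mono_neutral_right) (auto simp: F'_def)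
  finally have f: "f = (\<Sum>m\<in>F'. const (c m) * rep X m)" .
  hence "F' \<noteq> {}" using assms(2) by auto
  then obtain m where m: "m \<in> F'" "\<And>k. k \<in> F' \<Longrightarrow> k = m \<or> lt k m"
    using lt_max_exists[OF \<open>finite F'\<close>] by blast
  have "Poly_Mapping.lookup f m = (\<Sum>k\<in>F'. c k * Poly_Mapping.lookup (rep X k) m)"
    by (simp add: f lookup_sum)
  also have "\<dots> = (\<Sum>k\<in>{m}. c k * Poly_Mapping.lookup (rep X k) m)"
  proof (rule sum.mono_neutral_right)
    show "\<forall>k\<in>F' - {m}. c k * Poly_Mapping.lookup (rep X k) m = 0"
    proof
      fix k assume k: "k \<in> F' - {m}"
      hence "\<not> lt m k" "k \<in> S" using m(2)[of k] F(1) by (auto simp: lt_iff F'_def)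
      thus "c k * Poly_Mapping.lookup (rep X k) m = 0" using rep_lookup(2)[of k X m] k by (metis DiffD2 insertCI mult_zero_right)
    qed
  qed (use \<open>finite F'\<close> m in auto)
  also have "\<dots> = c m" using m(1) F(1) by (auto simp: F'_def rep_lookup(1))
  finally have "m \<in> Poly_Mapping.keys f" using m(1) by (simp add: in_keys_iff F'_def)
  moreover have "k = m \<or> lt k m" if "k \<in> Poly_Mapping.keys f" for k
  proof -
    have "(\<Sum>k'\<in>F'. c k' * Poly_Mapping.lookup (rep X k') k) \<noteq> 0"
      using that by (simp add: f lookup_sum in_keys_iff)
    then obtain k' where k': "k' \<in> F'" "c k' * Poly_Mapping.lookup (rep X k') k \<noteq> 0"
      by (rule sum.not_neutral_contains_not_neutral)
    hence "Poly_Mapping.lookup (rep X k') k \<noteq> 0" "k' \<in> S" using F(1) by (auto simp: F'_def)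
    hence "k = k' \<or> lt k k'" by (intro rep_lookup(2))
    thus ?thesis using m(2)[OF k'(1)] by (auto simp: lt_iff)
  qed
  moreover have "m \<in> S" using m(1) F(1) by (auto simp: F'_def)
  ultimately show ?thesis by (rule that[rotated])
qed

lemma standard_independent:
  assumes "q \<in> fam_ideal X" "q \<in> supported (- S)"
  shows "q = 0"
proof (rule ccontr)
  assume "q \<noteq> 0"
  then obtain m where "m \<in> S" "m \<in> Poly_Mapping.keys q"
    by (rule fam_ideal_lead[OF assms(1)])
  thus False using assms(2) by (auto simp: supported_def)
qed

text \<open>
  Over a ring that is not a field it matters that the leading coefficients of the \<open>rep X m\<close> are 1:
  each monomial of S is itself an initial term.
\<close>

lemma init_ideal_fam_ideal: "init_ideal lt (fam_ideal X) = supported S"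
proof
  show "init_ideal lt (fam_ideal X) \<subseteq> supported S"
    unfolding init_ideal_def
  proof (intro idl.span_minimal supported_ideal S_closed subsetI)
    fix g assume "g \<in> init_term lt ` (fam_ideal X - {0})"
    then obtain f where f: "f \<in> fam_ideal X" "f \<noteq> 0" "g = init_term lt f" by auto
    obtain m where "m \<in> S" "m \<in> Poly_Mapping.keys f" "\<And>k. k \<in> Poly_Mapping.keys f \<Longrightarrow> k = m \<or> lt k m"
      using fam_ideal_lead[OF f(1,2)] by blast
    hence "lead_mon lt f \<in> S" using lead_mon_eqI by metis
    thus "g \<in> supported S" by (auto simp: f(3) init_term_def supported_iff lookup_single when_def)
  qed
  show "supported S \<subseteq> init_ideal lt (fam_ideal X)"
    unfolding init_ideal_def
  proof (intro supported_subset_ideal idl.subspace_span idl.span_base)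
    fix m assume m: "m \<in> S"
    have "lead_mon lt (rep X m) = m"
      using rep_lookup[OF m, of X] by (intro lead_mon_eqI) (auto simp: in_keys_iff)
    hence "monom m = init_term lt (rep X m)"
      by (simp add: init_term_def monom_def rep_lookup(1)[OF m])
    moreover have "rep X m \<noteq> 0" using rep_lookup(1)[OF m, of X] by auto
    ultimately show "monom m \<in> init_term lt ` (fam_ideal X - {0})"
      using rep_in_fam_ideal[OF m] by auto
  qed
qed

lemma homog_fam: 
  assumes "i < e"
  shows "homog \<alpha> \<beta> (mdeg \<alpha> \<beta> (gen i)) (fam lt \<rho> S X i)"
  unfolding fam_eq_pathsum[OF assms] pathsum_def homog_iff_supported
  using path_len_le[OF assms]
  by (intro lin.subspace_sum lin.subspace_scale supported_subspace supported_monom)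
     (auto simp: mdeg_rm)

lemma homog_ideal_fam_ideal: "homog_ideal \<alpha> \<beta> (fam_ideal X)"
  unfolding homog_ideal_def
proof (intro conjI antisym is_ideal_fam_ideal)
  let ?G = "{f \<in> fam_ideal X. \<exists>d. homog \<alpha> \<beta> d f}"
  show "ideal_gen ?G \<subseteq> fam_ideal X"
    by (intro idl.span_minimal is_ideal_fam_ideal) auto
  have "fam lt \<rho> S X ` {..<e} \<subseteq> ?G"
    using homog_fam by (auto simp: fam_ideal_def intro: idl.span_base)
  thus "fam_ideal X \<subseteq> ideal_gen ?G"
    by (subst fam_ideal_def) (rule idl.span_mono)
qed

section \<open>Iterated reduction\<close>

text \<open>
  Walks and strolls are two instances of one construction: the monomials of S are reduced step by
  step, with the steps available at m given by \<open>T m\<close>, until a standard monomial is reached.  The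
  steps of a walk are paths and those of a stroll are walks.  The empty chain at a standard monomial
  is the trivial stroll.
\<close>

inductive chain :: "(mon \<Rightarrow> 't set) \<Rightarrow> ('t \<Rightarrow> nat) \<Rightarrow> mon \<Rightarrow> 't list \<Rightarrow> bool"
  for T len
  where
    chain_Nil: "m \<notin> S \<Longrightarrow> chain T len m []"
  | chain_Cons: "\<lbrakk>m \<in> S; t \<in> T m; chain T len (rm (len t) m) Z\<rbrakk> \<Longrightarrow> chain T len m (t # Z)"

abbreviation tot :: "('t \<Rightarrow> nat) \<Rightarrow> 't list \<Rightarrow> nat"
  where "tot len Z \<equiv> sum_list (map len Z)"

lemma chain_Nil_iff: "chain T len m [] \<longleftrightarrow> m \<notin> S"
  by (auto elim: chain.cases intro: chain.intros)

lemma chain_Cons_iff: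
  "chain T len m (t # Z) \<longleftrightarrow> m \<in> S \<and> t \<in> T m \<and> chain T len (rm (len t) m) Z"
  by (auto elim: chain.cases intro: chain.intros)

lemma chain_standard: "m \<notin> S \<Longrightarrow> chain T len m Z \<longleftrightarrow> Z = []"
  by (cases Z) (auto simp: chain_Nil_iff chain_Cons_iff)

lemma rmul_eq_rm: "rmul \<rho> l m = (if A * l \<le> u m then Some (rm l m) else None)"
  by (simp add: rmul_eq rm_def)

lemma rmul_add:
  assumes "A * k \<le> u m"
  shows "rmul \<rho> (k + l) m = rmul \<rho> l (rm k m)"
proof -
  have "A * (k + l) \<le> u m \<longleftrightarrow> A * l \<le> u m - A * k" using assms by (auto simp: algebra_simps)
  thus ?thesis by (simp only: rmul_eq_rm rm_add u_rm)
qed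

text \<open>
  The non-recursive form of the condition is the one used in the definition of walks and strolls.
\<close>

lemma chain_iff:
  assumes T: "\<And>m t. m \<in> S \<Longrightarrow> t \<in> T m \<Longrightarrow> A * len t \<le> u m"
    and "m \<in> S"
  shows "chain T len m Z \<longleftrightarrow> Z \<noteq> [] \<and>
    (\<forall>k<length Z. \<exists>m'. rmul \<rho> (tot len (take k Z)) m = Some m' \<and> m' \<in> S \<and> Z ! k \<in> T m') \<and>
    (\<exists>s. rmul \<rho> (tot len Z) m = Some s \<and> s \<notin> S)"
  using \<open>m \<in> S\<close>
proof (induction Z arbitrary: m)
  case Nil
  thus ?case by (simp add: chain_Nil_iff)
next
  case (Cons t Z)
  show ?case
  proof (cases "t \<in> T m")
    case False
    hence "\<not> (\<exists>m'. rmul \<rho> (tot len (take 0 (t # Z))) m = Some m' \<and> m' \<in> S \<and> (t # Z) ! 0 \<in> T m')"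
      by (simp add: rmul_Some)
    thus ?thesis using False by (fastforce simp: chain_Cons_iff)
  next
    case True
    let ?m = "rm (len t) m"
    have len: "A * len t \<le> u m" using T Cons.prems True by blast
    have "(\<forall>k<length (t # Z). \<exists>m'. rmul \<rho> (tot len (take k (t # Z))) m = Some m' \<and> m' \<in> S
          \<and> (t # Z) ! k \<in> T m') \<longleftrightarrow>
        (\<forall>k<length Z. \<exists>m'. rmul \<rho> (tot len (take k Z)) ?m = Some m' \<and> m' \<in> S \<and> Z ! k \<in> T m')"
      using True Cons.prems
      by (simp add: All_less_Suc2 rmul_Some rmul_add[OF len] del: split_paired_Ex)
    moreover have "rmul \<rho> (tot len (t # Z)) m = rmul \<rho> (tot len Z) ?m"
      by (simp add: rmul_add[OF len])
    moreover have "chain T len ?m Z \<longleftrightarrow>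
        (\<forall>k<length Z. \<exists>m'. rmul \<rho> (tot len (take k Z)) ?m = Some m' \<and> m' \<in> S \<and> Z ! k \<in> T m') \<and>
        (\<exists>s. rmul \<rho> (tot len Z) ?m = Some s \<and> s \<notin> S)"
    proof (cases "?m \<in> S")
      case True
      show ?thesis
      proof (cases "Z = []")
        case True
        thus ?thesis using \<open>?m \<in> S\<close> by (simp add: chain_Nil_iff rmul_Some)
      qed (simp add: Cons.IH[OF True])
    next
      case False
      show ?thesis
      proof (cases Z)
        case Nil
        thus ?thesis using False by (simp add: chain_Nil_iff rmul_Some)
      next
        case (Cons t' Z')
        hence "\<not> (\<exists>m'. rmul \<rho> (tot len (take 0 Z)) ?m = Some m' \<and> m' \<in> S \<and> Z ! 0 \<in> T m')"
          using False by (simp add: rmul_Some)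
        moreover have "0 < length Z" using Cons by simp
        ultimately show ?thesis using False Cons by (auto simp: chain_standard)
      qed
    qed
    ultimately show ?thesis using Cons.prems True by (simp add: chain_Cons_iff)
  qed
qed

lemma chain_end:
  assumes T: "\<And>m t. m \<in> S \<Longrightarrow> t \<in> T m \<Longrightarrow> A * len t \<le> u m"
    and "chain T len m Z"
  shows "A * tot len Z \<le> u m" "rm (tot len Z) m \<notin> S"
  using assms(2)
proof (induction)
  case (chain_Cons m t Z)
  have "A * len t \<le> u m" using T chain_Cons by blast
  {
    case 1
    show ?case using chain_Cons.IH(1) \<open>A * len t \<le> u m\<close> by (simp add: algebra_simps)
  next
    case 2
    show ?case using chain_Cons.IH(2) by (simp add: rm_add)
  }
qed simp_all

text \<open>
  The result of reducing m along all chains; each step replaces a monomial by minus a tail,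
  which accounts for the sign.
\<close>

definition chain_sum ::
    "(mon \<Rightarrow> 't set) \<Rightarrow> ('t \<Rightarrow> nat) \<Rightarrow> ('t \<Rightarrow> 'a::comm_ring_1) \<Rightarrow> mon \<Rightarrow> 'a poly2"
  where "chain_sum T len c m = (\<Sum>Z | chain T len m Z.
    const ((- 1) ^ length Z * prod_list (map c Z)) * monom (rm (tot len Z) m))"

lemma chain_sum_standard: "m \<notin> S \<Longrightarrow> chain_sum T len c m = monom m"
  by (simp add: chain_sum_def chain_standard)

lemma chain_set_rec:
  assumes "m \<in> S"
  shows "{Z. chain T len m Z} =
    (\<lambda>(t, Z). t # Z) ` Sigma (T m) (\<lambda>t. {Z. chain T len (rm (len t) m) Z})"
proof (intro equalityI subsetI)
  fix Z assume "Z \<in> {Z. chain T len m Z}"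
  hence Z: "chain T len m Z" by simp
  show "Z \<in> (\<lambda>(t, Z). t # Z) ` Sigma (T m) (\<lambda>t. {Z. chain T len (rm (len t) m) Z})"
  proof (cases Z)
    case Nil
    thus ?thesis using Z assms by (simp add: chain_Nil_iff)
  next
    case (Cons t Z')
    thus ?thesis using Z by (intro image_eqI[of _ _ "(t, Z')"]) (auto simp: chain_Cons_iff)
  qed
qed (use assms in \<open>auto simp: chain_Cons_iff\<close>)

context
  fixes T :: "mon \<Rightarrow> 't set" and len :: "'t \<Rightarrow> nat"
  assumes T_finite: "\<And>m. m \<in> S \<Longrightarrow> finite (T m)"
    and T_len: "\<And>m t. m \<in> S \<Longrightarrow> t \<in> T m \<Longrightarrow> 0 < len t \<and> A * len t \<le> u m"
begin

lemma u_step: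
  assumes "m \<in> S" "t \<in> T m"
  shows "u (rm (len t) m) < u m"
proof -
  have "0 < A * len t" "A * len t \<le> u m" using T_len[OF assms] A_pos by auto
  thus ?thesis unfolding u_rm by linarith
qed

lemma finite_chains: "finite {Z. chain T len m Z}"
proof (induction "u m" arbitrary: m rule: less_induct)
  case less
  show ?case
  proof (cases "m \<in> S")
    case True
    thus ?thesis unfolding chain_set_rec[OF True]
      using T_finite u_step less by (intro finite_imageI finite_SigmaI) auto
  next
    case False
    hence "{Z. chain T len m Z} = {[]}" by (auto simp: chain_standard)
    thus ?thesis by (metis finite.emptyI finite_insert)
  qed
qed

lemma chain_sum_rec:
  assumes "m \<in> S"
  shows "chain_sum T len c m = - (\<Sum>t\<in>T m. const (c t) * chain_sum T len c (rm (len t) m))"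
proof -
  let ?C = "Sigma (T m) (\<lambda>t. {Z. chain T len (rm (len t) m) Z})"
  have "chain_sum T len c m = (\<Sum>(t, Z)\<in>?C.
      - (const (c t) * (const ((- 1) ^ length Z * prod_list (map c Z)) *
        monom (rm (tot len Z) (rm (len t) m)))))"
    unfolding chain_sum_def chain_set_rec[OF assms]
    by (subst sum.reindex)
       (auto simp: inj_on_def rm_add const_mult const_uminus algebra_simps intro!: sum.cong)
  also have "\<dots> = - (\<Sum>t\<in>T m. const (c t) * chain_sum T len c (rm (len t) m))"
    by (subst sum.Sigma[symmetric])
       (auto simp: T_finite assms finite_chains chain_sum_def sum_distrib_left sum_negf)
  finally show ?thesis .
qed

lemma chain_sum_congruent:
  fixes I :: "'a::comm_ring_1 poly2 set"
  assumes I: "is_ideal I"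
    and rel: "\<And>m. m \<in> S \<Longrightarrow> monom m + (\<Sum>t\<in>T m. const (c t) * monom (rm (len t) m)) \<in> I"
  shows "monom m - chain_sum T len c m \<in> I"
proof (induction "u m" arbitrary: m rule: less_induct)
  case less
  show ?case
  proof (cases "m \<in> S")
    case True
    have "monom m - chain_sum T len c m =
        (monom m + (\<Sum>t\<in>T m. const (c t) * monom (rm (len t) m))) -
        (\<Sum>t\<in>T m. const (c t) * (monom (rm (len t) m) - chain_sum T len c (rm (len t) m)))"
      by (simp add: chain_sum_rec[OF True] right_diff_distrib sum_subtractf)
    also have "\<dots> \<in> I"
    proof (rule idl.subspace_diff[OF I rel[OF True]], rule idl.subspace_sum[OF I],
        rule idl.subspace_scale[OF I])
      fix t assume "t \<in> T m"
      hence "u (rm (len t) m) < u m" using True by (rule u_step[rotated])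
      thus "monom (rm (len t) m) - chain_sum T len c (rm (len t) m) \<in> I" by (rule less)
    qed
    finally show ?thesis .
  qed (simp add: chain_sum_standard idl.subspace_0[OF I])
qed

end

lemma walk_coeff_eq: "walk_coeff X W = - ((- 1) ^ length W * prod_list (map (path_coeff X) W))"
  by (simp add: walk_coeff_def)

definition path_steps :: "mon \<Rightarrow> path set"
  where "path_steps m = paths (jmax lt S m)"

definition walk_steps :: "mon \<Rightarrow> walk set"
  where "walk_steps m = {W. \<exists>t. t \<notin> S \<and> is_walk lt \<rho> S (jmax lt S m) t W}"

lemma paths_subset: "paths i \<subseteq> paths0 i - {[]}"
  using is_path_head by (auto simp: paths0_def paths_def)

lemma path_steps_props:
  assumes "m \<in> S"
  shows "finite (path_steps m)"
    and "P \<in> path_steps m \<Longrightarrow> 0 < path_len P \<and> A * path_len P \<le> u m"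
  using finite_paths0[OF jmax_less[OF assms]] paths_subset[of "jmax lt S m"]
    path_len_le[OF jmax_less[OF assms], of P] path_len_pos[OF jmax_less[OF assms], of P]
    u_gen_jmax[OF assms]
  by (auto simp: path_steps_def intro: finite_subset)

lemma walk_len_eq: "walk_len = tot path_len"
  by (rule ext) (simp add: walk_len_def)

lemma stroll_len_eq: "stroll_len = tot walk_len"
  by (rule ext) (simp add: stroll_len_def)

lemma all_between_Suc: "(\<forall>k. Suc 0 \<le> k \<and> k < Suc n \<longrightarrow> P k) \<longleftrightarrow> (\<forall>k<n. P (Suc k))"
  by (metis Suc_le_mono Suc_less_eq bot_nat_0.extremum not0_implies_Suc not_one_le_zero One_nat_def)

lemma is_walk_iff:
  assumes "i < e" "s \<notin> S"
  shows "is_walk lt \<rho> S i s W \<longleftrightarrow>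
    chain path_steps path_len (gen i) W \<and> rmul \<rho> (walk_len W) (gen i) = Some s"
proof -
  have "is_path lt \<rho> S i (W ! 0) \<longleftrightarrow> (\<exists>m'. rmul \<rho> (tot path_len (take 0 W)) (gen i) = Some m' \<and>
      m' \<in> S \<and> W ! 0 \<in> path_steps m')"
    using gen_in[OF assms(1)] jmax_gen[OF assms(1)] by (simp add: rmul_Some path_steps_def paths_def)
  hence "(W \<noteq> [] \<and> is_path lt \<rho> S i (W ! 0) \<and>
      (\<forall>k. 1 \<le> k \<and> k < length W \<longrightarrow>
        (\<exists>m. rmul \<rho> (walk_len (take k W)) (gen i) = Some m \<and> m \<in> S \<and>
          is_path lt \<rho> S (jmax lt S m) (W ! k)))) \<longleftrightarrow>
      (W \<noteq> [] \<and> (\<forall>k<length W. \<exists>m'. rmul \<rho> (tot path_len (take k W)) (gen i) = Some m' \<and>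
        m' \<in> S \<and> W ! k \<in> path_steps m'))"
    by (cases W) (simp_all add: all_between_Suc All_less_Suc2 walk_len_eq path_steps_def paths_def
      del: split_paired_Ex)
  moreover have "chain path_steps path_len (gen i) W \<longleftrightarrow> W \<noteq> [] \<and>
      (\<forall>k<length W. \<exists>m'. rmul \<rho> (tot path_len (take k W)) (gen i) = Some m' \<and> m' \<in> S \<and>
        W ! k \<in> path_steps m') \<and>
      (\<exists>s. rmul \<rho> (tot path_len W) (gen i) = Some s \<and> s \<notin> S)"
    using path_steps_props(2) gen_in[OF assms(1)] by (intro chain_iff) auto
  ultimately show ?thesis unfolding is_walk_def walk_len_eq using assms(2) by blast
qed

lemma walk_steps_eq:
  assumes "m \<in> S"
  shows "walk_steps m = {W. chain path_steps path_len (gen (jmax lt S m)) W}"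
proof -
  have "chain path_steps path_len (gen (jmax lt S m)) W \<Longrightarrow>
      \<exists>t. t \<notin> S \<and> rmul \<rho> (walk_len W) (gen (jmax lt S m)) = Some t" for W
    using chain_end[of path_steps path_len "gen (jmax lt S m)" W] path_steps_props(2)
    by (auto simp: walk_len_eq rmul_Some simp del: split_paired_Ex)
  thus ?thesis unfolding walk_steps_def using is_walk_iff jmax_less[OF assms] by blast
qed

lemma walk_len_pos:
  assumes "i < e" "chain path_steps path_len (gen i) W"
  shows "0 < walk_len W"
proof (cases W)
  case Nil
  thus ?thesis using assms gen_in by (simp add: chain_Nil_iff)
next
  case (Cons P W')
  hence "P \<in> path_steps (gen i)" using assms by (simp add: chain_Cons_iff)
  thus ?thesis using path_steps_props(2)[OF gen_in[OF assms(1)]] Cons by (simp add: walk_len_eq)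
qed

lemma walk_steps_props:
  assumes "m \<in> S"
  shows "finite (walk_steps m)"
    and "W \<in> walk_steps m \<Longrightarrow> 0 < walk_len W \<and> A * walk_len W \<le> u (gen (jmax lt S m))"
    and "W \<in> walk_steps m \<Longrightarrow> 0 < walk_len W \<and> A * walk_len W \<le> u m"
proof -
  show "finite (walk_steps m)" unfolding walk_steps_eq[OF assms]
    using path_steps_props by (intro finite_chains) auto
  show "0 < walk_len W \<and> A * walk_len W \<le> u (gen (jmax lt S m))" if "W \<in> walk_steps m"
    using that chain_end(1)[of path_steps path_len _ W] path_steps_props(2) walk_len_pos
      jmax_less[OF assms] unfolding walk_steps_eq[OF assms] walk_len_eq by auto
  thus "0 < walk_len W \<and> A * walk_len W \<le> u m" if "W \<in> walk_steps m"
    using that u_gen_jmax[OF assms] by force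
qed

lemma path_relation:
  assumes "m \<in> S"
  shows "monom m + (\<Sum>P\<in>path_steps m. const (path_coeff X P) * monom (rm (path_len P) m)) \<in> fam_ideal X"
proof -
  have "rep X m = monom m +
      (\<Sum>P\<in>path_steps m. const (path_coeff X P) * monom (rm (path_len P) m))"
    unfolding rep_def pathsum_def path_steps_def paths0_def
    using path_steps_props(1)[OF assms] paths_subset
    by (subst sum.insert) (auto simp: path_steps_def)
  thus ?thesis using rep_in_fam_ideal[OF assms, of X] by simp
qed

text \<open>
  These are the multiples of the elements of the reduced Groebner basis: the generator \<open>m_j\<close> is
  reduced along its walks, and the result is multiplied by \<open>m / m_j\<close>.
\<close>

lemma walk_relation:
  assumes "m \<in> S"
  shows "monom m + (\<Sum>W\<in>walk_steps m. const (walk_coeff X W) * monom (rm (walk_len W) m)) \<in> fam_ideal X"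
proof -
  let ?j = "jmax lt S m"
  obtain d where d: "m = d + gen ?j"
    using jmax_mdvd[OF assms] by (rule mdvd_obtain)
  have "monom (gen ?j) - chain_sum path_steps path_len (path_coeff X) (gen ?j) \<in> fam_ideal X"
    using path_steps_props path_relation by (intro chain_sum_congruent is_ideal_fam_ideal) auto
  also have "monom (gen ?j) - chain_sum path_steps path_len (path_coeff X) (gen ?j) =
      monom (gen ?j) + (\<Sum>W\<in>walk_steps m. const (walk_coeff X W) * monom (rm (walk_len W) (gen ?j)))"
    unfolding chain_sum_def walk_steps_eq[OF assms] walk_coeff_eq walk_len_eq
    by (simp add: const_uminus sum_negf)
  finally have "monom d * (monom (gen ?j) +
      (\<Sum>W\<in>walk_steps m. const (walk_coeff X W) * monom (rm (walk_len W) (gen ?j)))) \<in> fam_ideal X"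
    by (rule idl.subspace_scale[OF is_ideal_fam_ideal])
  also have "monom d * (monom (gen ?j) +
      (\<Sum>W\<in>walk_steps m. const (walk_coeff X W) * monom (rm (walk_len W) (gen ?j)))) =
      monom m + (\<Sum>W\<in>walk_steps m. const (walk_coeff X W) * monom (rm (walk_len W) m))"
  proof -
    have "rm (walk_len W) m = d + rm (walk_len W) (gen ?j)" if "W \<in> walk_steps m" for W
      using walk_steps_props(2)[OF assms that] by (subst (1) d) (simp add: rm_plus)
    moreover have "monom m = monom d * (monom (gen ?j) :: 'a poly2)"
      using d by (metis monom_mult)
    ultimately show ?thesis
      by (simp add: distrib_left sum_distrib_left mult.left_commute flip: monom_mult)
  qed
  finally show ?thesis .
qed

abbreviation strolls :: "mon \<Rightarrow> stroll set"
  where "strolls m \<equiv> {Q. chain walk_steps walk_len m Q}"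

lemma is_stroll_iff:
  "is_stroll lt \<rho> S m s Q \<longleftrightarrow> Q \<in> strolls m \<and> rmul \<rho> (stroll_len Q) m = Some s"
proof (cases "m \<in> S")
  case True
  define R where "R \<longleftrightarrow> (\<forall>k<length Q. \<exists>m'. rmul \<rho> (tot walk_len (take k Q)) m = Some m' \<and> m' \<in> S \<and>
    Q ! k \<in> walk_steps m')"
  have "chain walk_steps walk_len m Q \<longleftrightarrow>
      Q \<noteq> [] \<and> R \<and> (\<exists>s. rmul \<rho> (tot walk_len Q) m = Some s \<and> s \<notin> S)"
    unfolding R_def using walk_steps_props(3) True by (intro chain_iff) auto
  moreover have "is_stroll lt \<rho> S m s Q \<longleftrightarrow>
      s \<notin> S \<and> Q \<noteq> [] \<and> R \<and> rmul \<rho> (tot walk_len Q) m = Some s"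
    unfolding is_stroll_def R_def stroll_len_eq walk_steps_def mem_Collect_eq using True by argo
  ultimately show ?thesis unfolding stroll_len_eq mem_Collect_eq by (metis option.inject)
next
  case False
  thus ?thesis by (auto simp: is_stroll_def chain_standard stroll_len_def rmul_Some)
qed

definition normal_form :: "(arrow \<Rightarrow> 'a::comm_ring_1) \<Rightarrow> mon \<Rightarrow> 'a poly2"
  where "normal_form X m =
    (\<Sum>Q\<in>strolls m. const (stroll_coeff X Q) * monom (rm (stroll_len Q) m))"

lemma finite_strolls: "finite (strolls m)"
  using walk_steps_props by (intro finite_chains) auto

lemma stroll_end:
  assumes "Q \<in> strolls m"
  shows "A * stroll_len Q \<le> u m" "rm (stroll_len Q) m \<notin> S"
  using chain_end[of walk_steps walk_len m Q] walk_steps_props(3) assms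
  unfolding stroll_len_eq by auto

lemma normal_form_congruent: "monom m - normal_form X m \<in> fam_ideal X"
proof -
  have "normal_form X m = chain_sum walk_steps walk_len (walk_coeff X) m"
    by (simp add: normal_form_def chain_sum_def stroll_coeff_def stroll_len_eq)
  moreover have "monom m - chain_sum walk_steps walk_len (walk_coeff X) m \<in> fam_ideal X"
    by (intro chain_sum_congruent walk_steps_props walk_relation is_ideal_fam_ideal)
  ultimately show ?thesis by simp
qed

lemma normal_form_standard: "normal_form X m \<in> supported (- S)"
  unfolding normal_form_def using stroll_end
  by (intro lin.subspace_sum lin.subspace_scale supported_subspace supported_monom) auto

lemma normal_form_homog: "homog \<alpha> \<beta> (mdeg \<alpha> \<beta> m) (normal_form X m)"
  unfolding normal_form_def homog_iff_supported using stroll_end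
  by (intro lin.subspace_sum lin.subspace_scale supported_subspace supported_monom)
     (auto simp: mdeg_rm)

section \<open>The family lies in the cell\<close>

lemma fam_ideal_quot_basis:
  assumes "0 < \<alpha>" "0 < \<beta>"
  shows "\<exists>b. quot_basis \<alpha> \<beta> 1 (fam_ideal X) d (card {s. s \<notin> S \<and> mdeg \<alpha> \<beta> s = d}) b"
proof (rule standard_monomials_quot_basis[OF assms _ standard_independent])
  fix f :: "'a poly2" assume f: "homog \<alpha> \<beta> d f"
  define q where "q = (\<Sum>m\<in>Poly_Mapping.keys f. const (Poly_Mapping.lookup f m) * normal_form X m)"
  have "q \<in> supported (- S)" unfolding q_def
    by (intro lin.subspace_sum lin.subspace_scale supported_subspace normal_form_standard)
  moreover have "homog \<alpha> \<beta> d (normal_form X m)" if "m \<in> Poly_Mapping.keys f" for m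
    using normal_form_homog[of m X] f that by (simp add: homog_def)
  hence "homog \<alpha> \<beta> d q"
    unfolding homog_iff_supported q_def
    by (intro lin.subspace_sum lin.subspace_scale supported_subspace)
  moreover have "f - q = (\<Sum>m\<in>Poly_Mapping.keys f.
      const (Poly_Mapping.lookup f m) * (monom m - normal_form X m))"
    unfolding q_def by (subst (1) poly_eq_sum_monom) (simp add: right_diff_distrib sum_subtractf)
  moreover have "\<dots> \<in> fam_ideal X"
    by (intro idl.subspace_sum idl.subspace_scale is_ideal_fam_ideal normal_form_congruent)
  ultimately show "\<exists>q. q \<in> supported (- S) \<and> homog \<alpha> \<beta> d q \<and> f - q \<in> fam_ideal X"
    by (intro exI[of _ q]) simp
qed

text \<open>
  This is the direction of Evain's theorem that is needed: the family consists of points of the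
  cell.  The quotient is free in each degree, so a single open set covers the spectrum of A.
\<close>

lemma fam_ideal_in_cell:
  fixes M :: "'k::field poly2 set" and \<eta> :: "'k \<Rightarrow> 'a::comm_ring_1"
  assumes "0 < \<alpha>" "0 < \<beta>" "monomial_ideal M" "has_hilbert_function \<alpha> \<beta> M H" "Mons M = S"
    and "algebra_map \<eta>"
  shows "fam_ideal X \<in> cell_points \<alpha> \<beta> H \<eta> lt M"
proof -
  have \<eta>: "\<eta> 1 = 1" "\<eta> 0 = 0"
    using assms(6) unfolding algebra_map_def by (auto, metis add_0 add_cancel_right_left)
  have "\<exists>b. quot_basis \<alpha> \<beta> 1 (fam_ideal X) d (H d) b" for d
    using fam_ideal_quot_basis[OF assms(1,2), of X d]
      monomial_ideal_hilbert_function[OF assms(1-4), of d] assms(5) by simp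
  hence "\<exists>G. finite G \<and> ideal_gen G = UNIV \<and>
      (\<forall>g\<in>G. \<exists>b. quot_basis \<alpha> \<beta> g (fam_ideal X) d (H d) b)" for d
  proof (intro exI[of _ "{1}"] conjI)
    have "x \<in> ideal_gen {1}" for x :: 'a
      using idl.span_scale[OF idl.span_base[of 1 "{1}"], of x] by simp
    thus "ideal_gen {1::'a} = UNIV" by auto
  qed auto
  hence "fam_ideal X \<in> hilb_points \<alpha> \<beta> H"
    using homog_ideal_fam_ideal by (simp add: hilb_points_def)
  thus ?thesis
    using init_ideal_fam_ideal extend_monomial_ideal[where \<eta> = \<eta>, OF assms(3) \<eta>(2,1)] assms(5)
    by (simp add: cell_points_def)
qed

end

section \<open>Points of a subring\<close>

text \<open>
  A point of the spectrum is a function on all polynomials that is a ring homomorphism on the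
  subring C only; the following lemmas show that the coefficients in question stay in C.
\<close>

locale ring_point =
  fixes C :: "'r::comm_ring_1 set" and \<phi> :: "'r \<Rightarrow> 's::comm_ring_1"
  assumes zero_in: "0 \<in> C" and one_in: "1 \<in> C" and minus_in: "a \<in> C \<Longrightarrow> - a \<in> C"
    and add_in: "a \<in> C \<Longrightarrow> b \<in> C \<Longrightarrow> a + b \<in> C"
    and mult_in: "a \<in> C \<Longrightarrow> b \<in> C \<Longrightarrow> a * b \<in> C"
    and map_zero: "\<phi> 0 = 0" and map_one: "\<phi> 1 = 1"
    and map_add: "a \<in> C \<Longrightarrow> b \<in> C \<Longrightarrow> \<phi> (a + b) = \<phi> a + \<phi> b"
    and map_mult: "a \<in> C \<Longrightarrow> b \<in> C \<Longrightarrow> \<phi> (a * b) = \<phi> a * \<phi> b"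
begin

lemma map_minus: "a \<in> C \<Longrightarrow> \<phi> (- a) = - \<phi> a"
  using map_add[of a "- a"] minus_in[of a] map_zero by (simp add: eq_neg_iff_add_eq_0 add.commute)

lemma map_sum:
  assumes "\<And>x. x \<in> F \<Longrightarrow> f x \<in> C"
  shows "sum f F \<in> C \<and> \<phi> (sum f F) = (\<Sum>x\<in>F. \<phi> (f x))"
  using assms
  by (induction F rule: infinite_finite_induct) (simp_all add: zero_in map_zero add_in map_add)

lemma map_prod_list:
  assumes "\<And>x. x \<in> set xs \<Longrightarrow> f x \<in> C \<and> \<phi> (f x) = g x"
  shows "prod_list (map f xs) \<in> C \<and> \<phi> (prod_list (map f xs)) = prod_list (map g xs)"
  using assms by (induction xs) (simp_all add: one_in map_one mult_in map_mult)

lemma map_sign: "(- 1) ^ n \<in> C \<and> \<phi> ((- 1) ^ n) = (- 1) ^ n"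
  using one_in minus_in[OF one_in] map_minus[OF one_in]
  by (induction n) (simp_all add: map_one minus_in map_minus)

lemma map_path_coeff:
  assumes "\<And>c. c \<in> set P \<Longrightarrow> X c \<in> C"
  shows "path_coeff X P \<in> C \<and> \<phi> (path_coeff X P) = path_coeff (\<lambda>c. \<phi> (X c)) P"
  unfolding path_coeff_def using assms by (intro map_prod_list) simp

lemma map_walk_coeff:
  assumes "\<And>P c. P \<in> set W \<Longrightarrow> c \<in> set P \<Longrightarrow> X c \<in> C"
  shows "walk_coeff X W \<in> C \<and> \<phi> (walk_coeff X W) = walk_coeff (\<lambda>c. \<phi> (X c)) W"
proof -
  have "prod_list (map (path_coeff X) W) \<in> C \<and>
      \<phi> (prod_list (map (path_coeff X) W)) = prod_list (map (path_coeff (\<lambda>c. \<phi> (X c))) W)"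
    using assms by (intro map_prod_list map_path_coeff)
  thus ?thesis unfolding walk_coeff_def using map_sign by (metis mult_in map_mult)
qed

lemma map_stroll_coeff:
  assumes "\<And>W P c. W \<in> set Q \<Longrightarrow> P \<in> set W \<Longrightarrow> c \<in> set P \<Longrightarrow> X c \<in> C"
  shows "stroll_coeff X Q \<in> C \<and> \<phi> (stroll_coeff X Q) = stroll_coeff (\<lambda>c. \<phi> (X c)) Q"
proof -
  have "prod_list (map (walk_coeff X) Q) \<in> C \<and>
      \<phi> (prod_list (map (walk_coeff X) Q)) = prod_list (map (walk_coeff (\<lambda>c. \<phi> (X c))) Q)"
    using assms by (intro map_prod_list map_walk_coeff)
  thus ?thesis unfolding stroll_coeff_def using map_sign by (metis mult_in map_mult)
qed

end

context lex_cell
begin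

lemma chain_elements: "chain T len m Z \<Longrightarrow> t \<in> set Z \<Longrightarrow> \<exists>m\<in>S. t \<in> T m"
  by (induction rule: chain.induct) auto

lemma stroll_arrows:
  assumes "Q \<in> strolls m" "W \<in> set Q" "P \<in> set W"
  shows "set P \<subseteq> sig_arrows lt \<rho> S"
proof -
  obtain m' where m': "m' \<in> S" "W \<in> walk_steps m'"
    using chain_elements[of walk_steps walk_len m Q W] assms by auto
  have "chain path_steps path_len (gen (jmax lt S m')) W"
    using m' walk_steps_eq by blast
  from chain_elements[OF this assms(3)] obtain m'' where "P \<in> path_steps m''"
    by (elim bexE)
  thus ?thesis using path_arrows by (simp add: path_steps_def paths_def)
qed

lemma paths0_arrows: "P \<in> paths0 i \<Longrightarrow> set P \<subseteq> sig_arrows lt \<rho> S"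
  using path_arrows by (auto simp: paths0_def paths_def)

text \<open>
  Evaluation of the universal family at a point commutes with its construction, as is clear from the
  expression by paths.
\<close>

lemma map_fam:
  assumes "ring_point C \<phi>" "\<And>c. c \<in> sig_arrows lt \<rho> S \<Longrightarrow> X c \<in> C" "i < e"
  shows "Poly_Mapping.map \<phi> (fam lt \<rho> S X i) = fam lt \<rho> S (\<lambda>c. \<phi> (X c)) i"
proof (rule poly_mapping_eqI)
  fix k
  interpret ring_point C \<phi> by fact
  have coeff: "path_coeff X P * of_bool b \<in> C \<and>
      \<phi> (path_coeff X P * of_bool b) = path_coeff (\<lambda>c. \<phi> (X c)) P * of_bool b"
    if "P \<in> paths0 i" for P b
    using map_path_coeff[of P X] paths0_arrows[OF that] assms(2)
    by (cases b) (auto simp: zero_in map_zero)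
  have "Poly_Mapping.lookup (Poly_Mapping.map \<phi> (fam lt \<rho> S X i)) k =
      \<phi> (\<Sum>P\<in>paths0 i. path_coeff X P * of_bool (k = rm (path_len P) (gen i)))"
    by (auto simp: map.rep_eq when_def map_zero fam_eq_pathsum[OF assms(3)] pathsum_def
        lookup_sum lookup_monom)
  also have "\<dots> = (\<Sum>P\<in>paths0 i. path_coeff (\<lambda>c. \<phi> (X c)) P * of_bool (k = rm (path_len P) (gen i)))"
    using coeff by (subst map_sum[THEN conjunct2]) auto
  also have "\<dots> = Poly_Mapping.lookup (fam lt \<rho> S (\<lambda>c. \<phi> (X c)) i) k"
    by (simp add: fam_eq_pathsum[OF assms(3)] pathsum_def lookup_sum lookup_monom)
  finally show "Poly_Mapping.lookup (Poly_Mapping.map \<phi> (fam lt \<rho> S X i)) k =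
      Poly_Mapping.lookup (fam lt \<rho> S (\<lambda>c. \<phi> (X c)) i) k" .
qed

lemma fam_ideal_map:
  assumes "ring_point C \<phi>" "\<And>c. c \<in> sig_arrows lt \<rho> S \<Longrightarrow> X c \<in> C"
  shows "ideal_gen {Poly_Mapping.map \<phi> (fam lt \<rho> S X i) | i. i < e} = fam_ideal (\<lambda>c. \<phi> (X c))"
proof -
  have "{Poly_Mapping.map \<phi> (fam lt \<rho> S X i) | i. i < e} =
      (\<lambda>i. Poly_Mapping.map \<phi> (fam lt \<rho> S X i)) ` {..<e}" by auto
  also have "\<dots> = fam lt \<rho> S (\<lambda>c. \<phi> (X c)) ` {..<e}"
    using map_fam[OF assms] by (intro image_cong) auto
  finally show ?thesis by (simp add: fam_ideal_def)
qed

end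

section \<open>The two cells\<close>

lemma lex_cell_pos:
  assumes "0 < \<alpha>" "0 < \<beta>" "\<And>m d. m \<in> S \<Longrightarrow> d + m \<in> S"
  shows "lex_cell lex (r_exp \<alpha> \<beta>) fst snd Pair \<alpha> \<beta> \<alpha> \<beta> S"
proof
  fix l m
  show "rmul (r_exp \<alpha> \<beta>) l m =
      (if \<alpha> * l \<le> snd m then Some (fst m + \<beta> * l, snd m - \<alpha> * l) else None)"
  proof -
    have "0 \<le> int (snd m) - int l * int \<alpha> \<longleftrightarrow> \<alpha> * l \<le> snd m"
      by (simp add: mult.commute flip: of_nat_mult)
    moreover have "nat (int (snd m) - int l * int \<alpha>) = snd m - \<alpha> * l"
      by (simp add: mult.commute nat_diff_distrib' flip: of_nat_mult)
    moreover have "nat (int (fst m) + int l * int \<beta>) = fst m + \<beta> * l"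
      by (simp add: mult.commute nat_add_distrib nat_mult_distrib)
    ultimately show ?thesis by (simp add: rmul_def r_exp_def Let_def)
  qed
qed (use assms in \<open>auto simp: mdvd_def mlcm_def lex_def mdeg_def\<close>)

lemma lex_cell_neg:
  assumes "0 < \<alpha>" "0 < \<beta>" "\<And>m d. m \<in> S \<Longrightarrow> d + m \<in> S"
  shows "lex_cell lex_opp (r_exp_opp \<alpha> \<beta>) snd fst (\<lambda>a b. (b, a)) \<beta> \<alpha> \<alpha> \<beta> S"
proof
  fix l m
  show "rmul (r_exp_opp \<alpha> \<beta>) l m =
      (if \<beta> * l \<le> fst m then Some (fst m - \<beta> * l, snd m + \<alpha> * l) else None)"
  proof -
    have "0 \<le> int (fst m) - int l * int \<beta> \<longleftrightarrow> \<beta> * l \<le> fst m"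
      by (simp add: mult.commute flip: of_nat_mult)
    moreover have "nat (int (fst m) - int l * int \<beta>) = fst m - \<beta> * l"
      by (simp add: mult.commute nat_diff_distrib' flip: of_nat_mult)
    moreover have "nat (int (snd m) + int l * int \<alpha>) = snd m + \<alpha> * l"
      by (simp add: mult.commute nat_add_distrib nat_mult_distrib)
    ultimately show ?thesis by (simp add: rmul_def r_exp_opp_def Let_def)
  qed
qed (use assms in \<open>auto simp: mdvd_def mlcm_def lex_opp_def mdeg_def\<close>)

section \<open>The coordinate ring\<close>

lemma coord_ring_supported:
  "coord_ring \<alpha> \<beta> M N =
    supported {t. Poly_Mapping.keys t \<subseteq> Inl ` arrows_pos \<alpha> \<beta> M \<union> Inr ` arrows_neg \<alpha> \<beta> N}"
  by (auto simp: coord_ring_def supported_def)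

lemma coord_ring_mult:
  assumes "p \<in> coord_ring \<alpha> \<beta> M N" "q \<in> coord_ring \<alpha> \<beta> M N"
  shows "p * q \<in> coord_ring \<alpha> \<beta> M N"
  unfolding coord_ring_def
proof (intro CollectI ballI)
  fix t assume "t \<in> Poly_Mapping.keys (p * q)"
  then obtain a b where ab: "a \<in> Poly_Mapping.keys p" "b \<in> Poly_Mapping.keys q" "t = a + b"
    using keys_mult by blast
  have "Poly_Mapping.keys t \<subseteq> Poly_Mapping.keys a \<union> Poly_Mapping.keys b"
    unfolding ab(3) by (rule keys_add)
  thus "Poly_Mapping.keys t \<subseteq> Inl ` arrows_pos \<alpha> \<beta> M \<union> Inr ` arrows_neg \<alpha> \<beta> N"
    using ab assms unfolding coord_ring_def by blast
qed

lemma coord_ring_const: "const c \<in> coord_ring \<alpha> \<beta> M N"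
  by (auto simp: coord_ring_def const_def)

lemma coord_ring_var:
  "v \<in> Inl ` arrows_pos \<alpha> \<beta> M \<union> Inr ` arrows_neg \<alpha> \<beta> N \<Longrightarrow> var v \<in> coord_ring \<alpha> \<beta> M N"
  by (auto simp: coord_ring_def var_def monom_def)

lemma coord_ring_subspace:
  "module.subspace (\<lambda>c f. const c * f) (coord_ring \<alpha> \<beta> M N)"
  unfolding coord_ring_supported by (rule supported_subspace)

lemma spec_point_ring_point:
  assumes "\<phi> \<in> spec_points \<eta> (coord_ring \<alpha> \<beta> M N)" "algebra_map \<eta>"
  shows "ring_point (coord_ring \<alpha> \<beta> M N) \<phi>"
proof
  have \<eta>: "\<eta> 1 = 1" "\<eta> 0 = 0"
    using assms(2) unfolding algebra_map_def by (auto, metis add_0 add_cancel_right_left)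
  show "\<phi> 0 = 0" "\<phi> 1 = 1"
    using assms(1) \<eta> unfolding spec_points_def by (metis (mono_tags, lifting) const_0 const_1 mem_Collect_eq)+
  show "1 \<in> coord_ring \<alpha> \<beta> M N" using coord_ring_const[of 1] by simp
qed (use assms(1) in \<open>auto simp: spec_points_def coord_ring_mult lin.subspace_0[OF coord_ring_subspace]
      lin.subspace_add[OF coord_ring_subspace] lin.subspace_neg[OF coord_ring_subspace]\<close>)

text \<open>
  The intersection of the ideals that contain G is an ideal of C only if it is not the empty
  intersection; C itself is one of the ideals.
\<close>

lemma is_ideal_of_hull:
  assumes "is_ideal_of C C" "G \<subseteq> C"
  shows "is_ideal_of C (is_ideal_of C hull G)"
proof -
  have "(is_ideal_of C hull G) \<subseteq> C" using assms by (intro hull_minimal)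
  thus ?thesis unfolding is_ideal_of_def hull_def by blast
qed

section \<open>The edge equations as coefficients of normal forms\<close>

text \<open>
  A point of the product of the two cells, with the values \<open>X_pos\<close> and \<open>X_neg\<close> of the coordinates
  and the ideals \<open>I_pos\<close> and \<open>I_neg\<close> that it classifies.
\<close>

locale edge_point =
  pos: lex_cell lex "r_exp \<alpha> \<beta>" fst snd Pair \<alpha> \<beta> \<alpha> \<beta> "Mons M" +
  neg: lex_cell lex_opp "r_exp_opp \<alpha> \<beta>" snd fst "\<lambda>a b. (b, a)" \<beta> \<alpha> \<alpha> \<beta> "Mons N" +
  ring_point "coord_ring \<alpha> \<beta> M N" \<phi>
  for \<alpha> \<beta> :: nat and M N :: "'k::field poly2 set" and \<phi> :: "'k coord_poly \<Rightarrow> 'a::comm_ring_1"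
begin

abbreviation X_pos :: "arrow \<Rightarrow> 'a" where "X_pos c \<equiv> \<phi> (var (Inl c))"
abbreviation X_neg :: "arrow \<Rightarrow> 'a" where "X_neg c \<equiv> \<phi> (var (Inr c))"

abbreviation I_pos :: "'a poly2 set" where "I_pos \<equiv> pos.fam_ideal X_pos"
abbreviation I_neg :: "'a poly2 set" where "I_neg \<equiv> neg.fam_ideal X_neg"

lemma fam_pos_eq: "fam_pos \<alpha> \<beta> M \<phi> = I_pos"
  unfolding fam_pos_def
  by (intro pos.fam_ideal_map[OF ring_point_axioms] coord_ring_var) (simp add: arrows_pos_def)

lemma fam_neg_eq: "fam_neg \<alpha> \<beta> N \<phi> = I_neg"
  unfolding fam_neg_def
  by (intro neg.fam_ideal_map[OF ring_point_axioms] coord_ring_var) (simp add: arrows_neg_def)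

abbreviation hike_set :: "nat \<Rightarrow> (path \<times> stroll) set"
  where "hike_set k \<equiv> Sigma (neg.paths0 k) (\<lambda>P. pos.strolls (neg.rm (path_len P) (neg.gen k)))"

abbreviation hike_end :: "nat \<Rightarrow> path \<times> stroll \<Rightarrow> mon"
  where "hike_end k h \<equiv> pos.rm (stroll_len (snd h)) (neg.rm (path_len (fst h)) (neg.gen k))"

text \<open>
  A nonempty path for N has positive length, so it increases the exponent of y and leads to a
  monomial that is larger in the order with x smaller than y.
\<close>

lemma hikes_eq:
  assumes k: "k < neg.e"
  shows "hikes \<alpha> \<beta> M N (neg.gen k) s = {h \<in> hike_set k. hike_end k h = s}"
proof -
  have start: "((P = [] \<and> m = neg.gen k) \<or>
     (\<exists>k' < neg.e. neg.gen k' = neg.gen k \<and> is_path lex_opp (r_exp_opp \<alpha> \<beta>) (Mons N) k' P \<and>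
        rmul (r_exp_opp \<alpha> \<beta>) (path_len P) (neg.gen k) = Some m \<and> lex (neg.gen k) m)) \<longleftrightarrow>
     P \<in> neg.paths0 k \<and> m = neg.rm (path_len P) (neg.gen k)" (is "?L \<longleftrightarrow> _") for P m
  proof (cases "P \<in> neg.paths k")
    case True
    hence P: "P \<in> neg.paths0 k" "P \<noteq> []" using neg.paths_subset by auto
    note len = neg.path_len_le[OF k P(1)] neg.path_len_pos[OF k P]
    have "lex (neg.gen k) (neg.rm (path_len P) (neg.gen k))"
      using len(2) pos.A_pos by (simp add: lex_def)
    thus ?thesis
      using P k len(1) True neg.gen_inj[OF _ k] unfolding neg.paths_def neg.rmul_Some_iff by blast
  next
    case False
    thus ?thesis using k neg.gen_inj[OF _ k] by (auto simp: neg.paths0_def neg.paths_def)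
  qed
  have "is_stroll lex (r_exp \<alpha> \<beta>) (Mons M) m s Q \<longleftrightarrow>
      Q \<in> pos.strolls m \<and> pos.rm (stroll_len Q) m = s" for m Q
    unfolding pos.is_stroll_iff pos.rmul_Some_iff using pos.stroll_end(1) by blast
  thus ?thesis unfolding hikes_def start by auto
qed

lemma finite_hike_set: "k < neg.e \<Longrightarrow> finite (hike_set k)"
  using neg.finite_paths0 pos.finite_strolls by (intro finite_SigmaI)

lemma hike_coeff_point:
  assumes "h \<in> hike_set k"
  shows "hike_coeff h \<in> coord_ring \<alpha> \<beta> M N \<and>
    \<phi> (hike_coeff h) = path_coeff X_neg (fst h) * stroll_coeff X_pos (snd h)"
proof -
  have h: "fst h \<in> neg.paths0 k" "snd h \<in> pos.strolls (neg.rm (path_len (fst h)) (neg.gen k))"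
    using assms by auto
  have "var (Inr c) \<in> coord_ring \<alpha> \<beta> M N" if "c \<in> set (fst h)" for c
    using neg.paths0_arrows[OF h(1)] that
    by (intro coord_ring_var UnI2 imageI) (unfold arrows_neg_def, blast)
  hence "path_coeff (\<lambda>c. var (Inr c)) (fst h) \<in> coord_ring \<alpha> \<beta> M N \<and>
      \<phi> (path_coeff (\<lambda>c. var (Inr c)) (fst h)) = path_coeff X_neg (fst h)"
    by (rule map_path_coeff)
  moreover have "var (Inl c) \<in> coord_ring \<alpha> \<beta> M N" if "W \<in> set (snd h)" "P \<in> set W" "c \<in> set P" for W P c
    using pos.stroll_arrows[OF h(2) that(1,2)] that(3)
    by (intro coord_ring_var UnI1 imageI) (unfold arrows_pos_def, blast)
  hence "stroll_coeff (\<lambda>c. var (Inl c)) (snd h) \<in> coord_ring \<alpha> \<beta> M N \<and>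
      \<phi> (stroll_coeff (\<lambda>c. var (Inl c)) (snd h)) = stroll_coeff X_pos (snd h)"
    by (rule map_stroll_coeff)
  ultimately show ?thesis unfolding hike_coeff_def by (simp add: mult_in map_mult)
qed

lemma edge_eq_point:
  assumes "k < neg.e"
  shows "edge_eq \<alpha> \<beta> M N (neg.gen k) s \<in> coord_ring \<alpha> \<beta> M N"
    and "\<phi> (edge_eq \<alpha> \<beta> M N (neg.gen k) s) =
      (\<Sum>h | h \<in> hike_set k \<and> hike_end k h = s. path_coeff X_neg (fst h) * stroll_coeff X_pos (snd h))"
  using map_sum[of "hikes \<alpha> \<beta> M N (neg.gen k) s" hike_coeff] hike_coeff_point[of _ k]
  unfolding edge_eq_def hikes_eq[OF assms] by auto

text \<open>
  The normal form modulo \<open>I_pos\<close> of the k-th generator of \<open>I_neg\<close>: each monomial on a path for N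
  is reduced along its strolls for M.
\<close>

definition remainder :: "nat \<Rightarrow> 'a poly2"
  where "remainder k = (\<Sum>h\<in>hike_set k.
    const (path_coeff X_neg (fst h) * stroll_coeff X_pos (snd h)) * monom (hike_end k h))"

lemma lookup_remainder:
  assumes "k < neg.e"
  shows "Poly_Mapping.lookup (remainder k) s = \<phi> (edge_eq \<alpha> \<beta> M N (neg.gen k) s)"
proof -
  have "Poly_Mapping.lookup (remainder k) s =
      (\<Sum>h\<in>hike_set k. path_coeff X_neg (fst h) * stroll_coeff X_pos (snd h) * of_bool (s = hike_end k h))"
    by (simp add: remainder_def lookup_sum lookup_monom)
  also have "\<dots> = (\<Sum>h | h \<in> hike_set k \<and> hike_end k h = s.
      path_coeff X_neg (fst h) * stroll_coeff X_pos (snd h))"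
    using finite_hike_set[OF assms] by (intro sum.mono_neutral_cong_right) auto
  finally show ?thesis using edge_eq_point(2)[OF assms] by simp
qed

lemma remainder_supported:
  assumes "k < neg.e"
  shows "remainder k \<in> supported {s. s \<notin> Mons M \<and> mdeg \<alpha> \<beta> s = mdeg \<alpha> \<beta> (neg.gen k)}"
  unfolding remainder_def
proof (intro lin.subspace_sum lin.subspace_scale supported_subspace supported_monom CollectI)
  fix h assume "h \<in> hike_set k"
  hence h: "fst h \<in> neg.paths0 k" "snd h \<in> pos.strolls (neg.rm (path_len (fst h)) (neg.gen k))"
    by auto
  thus "hike_end k h \<notin> Mons M \<and> mdeg \<alpha> \<beta> (hike_end k h) = mdeg \<alpha> \<beta> (neg.gen k)"
    using pos.stroll_end[OF h(2)] neg.path_len_le[OF assms h(1)]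
    by (simp add: pos.mdeg_rm neg.mdeg_rm)
qed

lemma remainder_congruent:
  assumes "k < neg.e"
  shows "fam lex_opp (r_exp_opp \<alpha> \<beta>) (Mons N) X_neg k - remainder k \<in> I_pos"
proof -
  let ?m = "\<lambda>P. neg.rm (path_len P) (neg.gen k)"
  have "remainder k = (\<Sum>P\<in>neg.paths0 k. const (path_coeff X_neg P) * pos.normal_form X_pos (?m P))"
    unfolding remainder_def pos.normal_form_def sum_distrib_left
    by (subst sum.Sigma)
       (auto simp: neg.finite_paths0[OF assms] pos.finite_strolls const_mult mult.assoc intro!: sum.cong)
  hence "fam lex_opp (r_exp_opp \<alpha> \<beta>) (Mons N) X_neg k - remainder k =
      (\<Sum>P\<in>neg.paths0 k. const (path_coeff X_neg P) * (monom (?m P) - pos.normal_form X_pos (?m P)))"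
    by (simp add: neg.fam_eq_pathsum[OF assms] neg.pathsum_def right_diff_distrib sum_subtractf)
  also have "\<dots> \<in> I_pos"
    by (intro idl.subspace_sum idl.subspace_scale pos.is_ideal_fam_ideal pos.normal_form_congruent)
  finally show ?thesis .
qed

text \<open>
  Standard monomials are independent modulo \<open>I_pos\<close>, so membership of the generator means that all
  coefficients of its normal form vanish.
\<close>

lemma fam_in_ideal_iff:
  assumes k: "k < neg.e"
  shows "fam lex_opp (r_exp_opp \<alpha> \<beta>) (Mons N) X_neg k \<in> I_pos \<longleftrightarrow>
    (\<forall>s. s \<notin> Mons M \<and> mdeg \<alpha> \<beta> s = mdeg \<alpha> \<beta> (neg.gen k) \<longrightarrow>
      \<phi> (edge_eq \<alpha> \<beta> M N (neg.gen k) s) = 0)"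
proof -
  let ?f = "fam lex_opp (r_exp_opp \<alpha> \<beta>) (Mons N) X_neg k"
  have "?f \<in> I_pos \<longleftrightarrow> remainder k \<in> I_pos"
    using idl.subspace_diff[OF pos.is_ideal_fam_ideal _ remainder_congruent[OF k], of ?f]
      idl.subspace_add[OF pos.is_ideal_fam_ideal _ remainder_congruent[OF k], of "remainder k"] by auto
  also have "\<dots> \<longleftrightarrow> remainder k = 0"
    using pos.standard_independent[of "remainder k" X_pos] remainder_supported[OF k]
      idl.subspace_0[OF pos.is_ideal_fam_ideal] by (auto simp: supported_def)
  also have "\<dots> \<longleftrightarrow> (\<forall>s. Poly_Mapping.lookup (remainder k) s = 0)"
    by (simp add: poly_mapping_eq_iff fun_eq_iff del: split_paired_All)
  also have "\<dots> \<longleftrightarrow> (\<forall>s. s \<notin> Mons M \<and> mdeg \<alpha> \<beta> s = mdeg \<alpha> \<beta> (neg.gen k) \<longrightarrow>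
      Poly_Mapping.lookup (remainder k) s = 0)"
    using remainder_supported[OF k] unfolding supported_iff mem_Collect_eq by blast
  finally show ?thesis by (simp add: lookup_remainder[OF k])
qed

lemma edge_ideal_vanishes_iff:
  "is_ideal_of (coord_ring \<alpha> \<beta> M N) (edge_ideal \<alpha> \<beta> M N)"
  "(\<forall>p\<in>edge_ideal \<alpha> \<beta> M N. \<phi> p = 0) \<longleftrightarrow> I_neg \<subseteq> I_pos"
proof -
  let ?C = "coord_ring \<alpha> \<beta> M N"
  define G where "G = {edge_eq \<alpha> \<beta> M N n s | n s.
      n \<in> min_gens (Mons N) \<and> s \<notin> Mons M \<and> mdeg \<alpha> \<beta> n = mdeg \<alpha> \<beta> s}"
  have G: "G = {edge_eq \<alpha> \<beta> M N (neg.gen k) s | k s.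
      k < neg.e \<and> s \<notin> Mons M \<and> mdeg \<alpha> \<beta> s = mdeg \<alpha> \<beta> (neg.gen k)}"
    unfolding G_def neg.gens_props(1)[symmetric] in_set_conv_nth
    by (intro Collect_cong) (auto simp del: split_paired_Ex, metis+)
  have J: "edge_ideal \<alpha> \<beta> M N = is_ideal_of ?C hull G"
    by (simp add: edge_ideal_def G_def)
  have GC: "G \<subseteq> ?C" unfolding G using edge_eq_point(1) by auto
  show "is_ideal_of ?C (edge_ideal \<alpha> \<beta> M N)"
    unfolding J using GC
    by (intro is_ideal_of_hull) (auto simp: is_ideal_of_def zero_in add_in mult_in)
  have "is_ideal_of ?C {p \<in> ?C. \<phi> p = 0}"
    by (auto simp: is_ideal_of_def zero_in add_in mult_in map_zero map_add map_mult)
  hence "edge_ideal \<alpha> \<beta> M N \<subseteq> {p \<in> ?C. \<phi> p = 0}" if "\<forall>p\<in>G. \<phi> p = 0"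
    unfolding J using that GC by (intro hull_minimal) blast+
  moreover have "G \<subseteq> edge_ideal \<alpha> \<beta> M N"
    unfolding J by (rule hull_subset)
  ultimately have "(\<forall>p\<in>edge_ideal \<alpha> \<beta> M N. \<phi> p = 0) \<longleftrightarrow> (\<forall>p\<in>G. \<phi> p = 0)"
    by blast
  also have "\<dots> \<longleftrightarrow> (\<forall>k<neg.e. fam lex_opp (r_exp_opp \<alpha> \<beta>) (Mons N) X_neg k \<in> I_pos)"
    unfolding G using fam_in_ideal_iff by blast
  also have "\<dots> \<longleftrightarrow> I_neg \<subseteq> I_pos"
  proof
    assume "\<forall>k<neg.e. fam lex_opp (r_exp_opp \<alpha> \<beta>) (Mons N) X_neg k \<in> I_pos"
    thus "I_neg \<subseteq> I_pos" unfolding neg.fam_ideal_def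
      by (intro idl.span_minimal pos.is_ideal_fam_ideal) auto
  next
    assume "I_neg \<subseteq> I_pos"
    moreover have "fam lex_opp (r_exp_opp \<alpha> \<beta>) (Mons N) X_neg k \<in> I_neg" if "k < neg.e" for k
      unfolding neg.fam_ideal_def using that by (intro idl.span_base imageI) simp
    ultimately show "\<forall>k<neg.e. fam lex_opp (r_exp_opp \<alpha> \<beta>) (Mons N) X_neg k \<in> I_pos" by blast
  qed
  finally show "(\<forall>p\<in>edge_ideal \<alpha> \<beta> M N. \<phi> p = 0) \<longleftrightarrow> I_neg \<subseteq> I_pos" .
qed

lemma cells_meet_iff:
  assumes "0 < \<alpha>" "0 < \<beta>"
    and "\<And>d. card {s. s \<notin> Mons M \<and> mdeg \<alpha> \<beta> s = d} = card {s. s \<notin> Mons N \<and> mdeg \<alpha> \<beta> s = d}"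
  shows "I_pos = I_neg \<longleftrightarrow> I_neg \<subseteq> I_pos"
proof (intro iffI antisym)
  assume sub: "I_neg \<subseteq> I_pos"
  show "I_pos \<subseteq> I_neg"
    unfolding pos.fam_ideal_def
  proof (intro idl.span_minimal neg.is_ideal_fam_ideal subsetI)
    fix f assume "f \<in> fam lex (r_exp \<alpha> \<beta>) (Mons M) X_pos ` {..<pos.e}"
    then obtain i where i: "i < pos.e" "f = fam lex (r_exp \<alpha> \<beta>) (Mons M) X_pos i" by blast
    let ?d = "mdeg \<alpha> \<beta> (pos.gen i)"
    obtain b b' where b: "quot_basis \<alpha> \<beta> 1 I_pos ?d (card {s. s \<notin> Mons M \<and> mdeg \<alpha> \<beta> s = ?d}) b"
      and b': "quot_basis \<alpha> \<beta> 1 I_neg ?d (card {s. s \<notin> Mons M \<and> mdeg \<alpha> \<beta> s = ?d}) b'"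
      using pos.fam_ideal_quot_basis[OF assms(1,2), of X_pos ?d]
        neg.fam_ideal_quot_basis[OF assms(1,2), of X_neg ?d] assms(3)[of ?d] by auto
    have "f \<in> I_pos" unfolding pos.fam_ideal_def i(2) using i(1) by (intro idl.span_base imageI) simp
    moreover have "homog \<alpha> \<beta> ?d f" unfolding i(2) using i(1) by (rule pos.homog_fam)
    ultimately show "f \<in> I_neg"
      by (rule same_rank_inclusion_eq[OF b b' pos.is_ideal_fam_ideal neg.is_ideal_fam_ideal sub])
  qed
qed auto

end

theorem theorem4p15:
  fixes \<alpha> \<beta> :: nat
    and H :: "nat \<Rightarrow> nat"
    and M N :: "'k::field poly2 set"
    and \<eta> :: "'k \<Rightarrow> 'a::comm_ring_1"
  assumes "0 < \<alpha>" and "0 < \<beta>" and "coprime \<alpha> \<beta>"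
    and "monomial_ideal M" and "finite_colength M"
    and "monomial_ideal N" and "finite_colength N"
    and "has_hilbert_function \<alpha> \<beta> M H" and "has_hilbert_function \<alpha> \<beta> N H"
    and "mon_ideal_greater \<alpha> \<beta> M N"
    and "algebra_map \<eta>"
  shows "defines_edge_scheme \<alpha> \<beta> H M N \<eta> (edge_ideal \<alpha> \<beta> M N)"
proof -
  note MN = \<open>monomial_ideal M\<close> \<open>monomial_ideal N\<close>
  note hilb = \<open>has_hilbert_function \<alpha> \<beta> M H\<close> \<open>has_hilbert_function \<alpha> \<beta> N H\<close>
  interpret pos: lex_cell lex "r_exp \<alpha> \<beta>" fst snd Pair \<alpha> \<beta> \<alpha> \<beta> "Mons M"
    using assms(1,2) Mons_closed[OF monomial_ideal_eq_supported(1)[OF MN(1)]]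
    by (rule lex_cell_pos)
  interpret neg: lex_cell lex_opp "r_exp_opp \<alpha> \<beta>" snd fst "\<lambda>a b. (b, a)" \<beta> \<alpha> \<alpha> \<beta> "Mons N"
    using assms(1,2) Mons_closed[OF monomial_ideal_eq_supported(1)[OF MN(2)]]
    by (rule lex_cell_neg)
  let ?C = "coord_ring \<alpha> \<beta> M N"
  have point: "(\<forall>p\<in>edge_ideal \<alpha> \<beta> M N. \<phi> p = 0) \<longleftrightarrow>
      (fam_pos \<alpha> \<beta> M \<phi>, fam_neg \<alpha> \<beta> N \<phi>) \<in> edge_points \<alpha> \<beta> H \<eta> M N"
    if "\<phi> \<in> spec_points \<eta> ?C" for \<phi>
  proof -
    interpret ring_point ?C \<phi> using that assms(11) by (rule spec_point_ring_point)
    interpret edge_point \<alpha> \<beta> M N \<phi> by unfold_locales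
    have "I_pos \<in> cell_points \<alpha> \<beta> H \<eta> lex M" "I_neg \<in> cell_points \<alpha> \<beta> H \<eta> lex_opp N"
      using pos.fam_ideal_in_cell neg.fam_ideal_in_cell assms(1,2,11) MN hilb by blast+
    hence "(fam_pos \<alpha> \<beta> M \<phi>, fam_neg \<alpha> \<beta> N \<phi>) \<in> edge_points \<alpha> \<beta> H \<eta> M N \<longleftrightarrow> I_pos = I_neg"
      by (simp add: edge_points_def fam_pos_eq fam_neg_eq)
    also have "\<dots> \<longleftrightarrow> I_neg \<subseteq> I_pos"
      using monomial_ideal_hilbert_function[OF assms(1,2) MN(1) hilb(1)]
        monomial_ideal_hilbert_function[OF assms(1,2) MN(2) hilb(2)]
      by (intro cells_meet_iff assms(1,2)) metis
    finally show ?thesis using edge_ideal_vanishes_iff(2) by simp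
  qed
  (* The identity is a point, so the edge equations lie in the coordinate ring. *)
  interpret idp: ring_point ?C "\<lambda>p. p"
    using coord_ring_const[of 1 \<alpha> \<beta> M N]
    by unfold_locales (simp_all add: coord_ring_mult lin.subspace_0[OF coord_ring_subspace]
      lin.subspace_add[OF coord_ring_subspace] lin.subspace_neg[OF coord_ring_subspace])
  interpret idp: edge_point \<alpha> \<beta> M N "\<lambda>p. p" by unfold_locales
  have "is_ideal_of ?C (edge_ideal \<alpha> \<beta> M N)" by (rule idp.edge_ideal_vanishes_iff(1))
  thus ?thesis unfolding defines_edge_scheme_def using point by blast
qed

end
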